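(* Let $T>0$, $\lambda>0$, let $n>\lambda T$ be an integer, $h=T/n$, $t_k=kh$ for $k=0,\dots,n$. Let $b:\mathbb{R}^d\to\mathbb{R}^d$, $\sigma:\mathbb{R}^d\to\mathbb{R}^{d\times q}$, $\gamma:\mathbb{R}^d\to\mathbb{R}^d$, and let $P$ be the transition of the Euler scheme of the jump diffusion with at most one jump per time step, $$Pf(x)=\mathbb{E}\,f\Big(x+h\,b(x)+\sqrt h\,\sigma(x)Z+\gamma(x)\big(J\,U-\lambda h\,\mathbb{E}\,U\big)\Big),$$ where $Z\sim\mathcal{N}(0,I_q)$, $J$ is Bernoulli with $\mathbb{P}(J=1)=\lambda h=1-\mathbb{P}(J=0)$, $U$ is a real random variable with distribution $\mu$ having a density and $\mathbb{E}\,U^2<+\infty$, and $Z,J,U$ are independent. Assume that $b$, $\sigma$ and $\gamma$ are twice differentiable and that $Db$, $D^2b$, $D\sigma$, $D\gamma$ and all the matrix-valued functions $(\partial^2_{x_ix_j}\sigma)\sigma^*$ and $(\partial^2_{x_ix_j}\gamma)\gamma^*$, $i,j\in\{1,\dots,d\}$, are bounded. Let $f:\mathbb{R}^d\to\mathbb{R}$ be twice differentiable with a Lipschitz gradient. (a) There exists a real constant $C>0$, depending only on the bounds of $Db$, $D^2b$, $D\sigma$, $D\gamma$, $(D^2\sigma)\sigma^*$, $(D^2\gamma)\gamma^*$ (and on $T$, $\lambda$ and the distribution $\mu$), and not depending on $h$, such that $$[Pf]_{\rm Lip}\le(1+Ch)[f]_{\rm Lip}\qquad\text{and}\qquad[\nabla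 Pf]_{\rm Lip}\le(1+Ch)[\nabla f]_{\rm Lip}+h\,\|D^2b\|_{\sup}\,\|\nabla f\|_{\sup}.$$ (b) As a consequence, for every $k\in\{0,\dots,n\}$, $$[\nabla P^kf]_{\rm Lip}\le e^{Ct_k}\Big([\nabla f]_{\rm Lip}+t_k\,\|D^2b\|_{\sup}\,\|\nabla f\|_{\sup}\Big).$$
   Context: $[g]_{\rm Lip}\in[0,+\infty]$ is the Lipschitz constant of $g$ with respect to Euclidean norms; $\|g\|_{\sup}\in[0,+\infty]$ is the supremum of the (Euclidean, respectively operator) norm of $g$; $\|D^2b\|_{\sup}=\sup_x\sup_{|u|,|v|\le1}|D^2b(x)(u,v)|$. $^*$ denotes the transpose, vectors of $\mathbb{R}^d$ being seen as $d\times1$ matrices, so $(\partial^2_{x_ix_j}\gamma)\gamma^*$ is $d\times d$. $P^k$ is the $k$-th iterate of $P$. The bounds in the inequalities are understood in $[0,+\infty]$. *)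

theory Defs
  imports "HOL-Probability.Probability"
begin

definition D1 :: "('a::real_normed_vector \<Rightarrow> 'b::real_normed_vector) \<Rightarrow> 'a \<Rightarrow> 'a \<Rightarrow>\<^sub>L 'b"
  where "D1 g x = Blinfun (frechet_derivative g (at x))"

definition D2 :: "('a::real_normed_vector \<Rightarrow> 'b::real_normed_vector) \<Rightarrow> 'a \<Rightarrow> 'a \<Rightarrow>\<^sub>L 'a \<Rightarrow>\<^sub>L 'b"
  where "D2 g = D1 (D1 g)"

definition twice_differentiable ::
    "('a::real_normed_vector \<Rightarrow> 'b::real_normed_vector) \<Rightarrow> bool"
  where "twice_differentiable g \<longleftrightarrow>
    (\<forall>x. g differentiable (at x)) \<and> (\<forall>x. D1 g differentiable (at x))"

definition partial2 :: "'d \<Rightarrow> 'd \<Rightarrow> (real^'d::finite \<Rightarrow> 'b::real_normed_vector) \<Rightarrow> real^'d \<Rightarrow> 'b"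
  where "partial2 i j g x = blinfun_apply (blinfun_apply (D2 g x) (axis i 1)) (axis j 1)"

definition grad :: "(real^'d::finite \<Rightarrow> real) \<Rightarrow> real^'d \<Rightarrow> real^'d"
  where "grad f x = (\<chi> i. frechet_derivative f (at x) (axis i 1))"

definition op_norm :: "real^'m::finite^'k::finite \<Rightarrow> real"
  where "op_norm A = onorm (\<lambda>v. A *v v)"

definition col_matrix :: "real^'d \<Rightarrow> real^1^'d"
  where "col_matrix v = columnvector v"

text \<open>The following quantities take values in \<open>[0, \<infinity>]\<close>; in \<^typ>\<open>ennreal\<close>, \<open>0 * \<infinity> = 0\<close>.\<close>

definition Lip_const :: "('a::metric_space \<Rightarrow> 'b::metric_space) \<Rightarrow> ennreal"
  where "Lip_const g = (SUP x. SUP y\<in>-{x}. ennreal (dist (g x) (g y) / dist x y))"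

definition sup_norm :: "('a \<Rightarrow> 'b::real_normed_vector) \<Rightarrow> ennreal"
  where "sup_norm g = (SUP x. ennreal (norm (g x)))"

definition D2_sup :: "('a::real_normed_vector \<Rightarrow> 'b::real_normed_vector) \<Rightarrow> ennreal"
  where "D2_sup g = (SUP x. SUP u\<in>cball 0 1. SUP v\<in>cball 0 1.
    ennreal (norm (blinfun_apply (blinfun_apply (D2 g x) u) v)))"

definition std_gaussian :: "(real^'q::finite) measure"
  where "std_gaussian = density lborel (\<lambda>z. ennreal (\<Prod>i\<in>UNIV. std_normal_density (z $ i)))"

text \<open>Joint law of the independent triple \<open>(Z, J, U)\<close>, with \<open>p\<close> the jump probability;
  the values of \<open>J\<close> are encoded as booleans.\<close>

definition noise :: "real \<Rightarrow> real measure \<Rightarrow> ((real^'q::finite) \<times> bool \<times> real) measure"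
  where "noise p \<mu> = std_gaussian \<Otimes>\<^sub>M (measure_pmf (bernoulli_pmf p) \<Otimes>\<^sub>M \<mu>)"

definition euler_step :: "real \<Rightarrow> real \<Rightarrow> real measure \<Rightarrow>
    (real^'d \<Rightarrow> real^'d) \<Rightarrow> (real^'d \<Rightarrow> real^'q^'d) \<Rightarrow> (real^'d \<Rightarrow> real^'d) \<Rightarrow>
    real^'d::finite \<Rightarrow> (real^'q::finite) \<times> bool \<times> real \<Rightarrow> real^'d"
  where "euler_step lam h \<mu> b \<sigma> \<gamma> x = (\<lambda>(z, j, u).
    x + h *\<^sub>R b x + sqrt h *\<^sub>R (\<sigma> x *v z)
      + (of_bool j * u - lam * h * (\<integral>v. v \<partial>\<mu>)) *\<^sub>R \<gamma> x)"

definition euler_transition :: "real \<Rightarrow> real \<Rightarrow> real measure \<Rightarrow>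
    (real^'d \<Rightarrow> real^'d) \<Rightarrow> (real^'d \<Rightarrow> real^'q::finite^'d) \<Rightarrow> (real^'d \<Rightarrow> real^'d) \<Rightarrow>
    (real^'d::finite \<Rightarrow> real) \<Rightarrow> real^'d \<Rightarrow> real"
  where "euler_transition lam h \<mu> b \<sigma> \<gamma> f x =
    (\<integral>w. f (euler_step lam h \<mu> b \<sigma> \<gamma> x w) \<partial>(noise (lam * h) \<mu>))"

end

theory Submission
  imports Defs
begin

text \<open>
  Write \<open>X\<^sub>x\<close> for one Euler step from \<open>x\<close> and \<open>DX\<close>, \<open>D\<^sup>2X\<close> for its derivatives in \<open>x\<close>.
  Since the Gaussian and the compensated jump are centred and independent, the second moments of
  \<open>X\<^sub>x - X\<^sub>y\<close> and of \<open>DX v\<close> are at most \<open>(1 + C h) \<bar>x - y\<bar>\<^sup>2\<close> and \<open>(1 + C h) \<bar>v\<bar>\<^sup>2\<close>; this gives the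
  bound for \<open>P f\<close> and the main term of
  \<open>D\<^sup>2(P f)(u, v) = E[D\<^sup>2f(X)(DX u, DX v)] + E[\<nabla>f(X) \<cdot> D\<^sup>2X(u, v)]\<close>.
  In the last expectation the drift contributes \<open>h \<parallel>D\<^sup>2b\<parallel> \<parallel>\<nabla>f\<parallel>\<close>. The Gaussian term gains a factor
  \<open>\<surd>h\<close> from Stein's identity, and only the product \<open>(D\<^sup>2\<sigma>)\<sigma>\<^sup>*\<close> remains. In the jump term \<open>\<nabla>f(X)\<close> may be
  replaced by its increment along \<open>\<gamma>\<close>, which leaves \<open>\<bar>D\<^sup>2\<gamma>\<bar> \<bar>\<gamma>\<bar>\<close> times the jump variance, of order \<open>h\<close>.
  If \<open>\<parallel>D\<^sup>2b\<parallel> \<parallel>\<nabla>f\<parallel>\<close> is infinite, the gradient of \<open>P f\<close> need not be Lipschitz; integrability and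
  differentiability of the iterates are then obtained from linear growth of the gradient.
\<close>

section \<open>Differentiation under the integral\<close>


text \<open>Second derivatives exist everywhere but need not be continuous, and those of
  \<open>\<sigma>\<close> and \<open>\<gamma>\<close> may be unbounded. Differentiation under the
  expectation therefore uses a domination around each point separately, and derivatives become
  measurable as limits of difference quotients. In the same spirit, Stein's identity is derived from
  the translation formula for the Gaussian density, which asks only for a differentiable Lipschitz
  function. The constant must be 1 + C h although a jump is not small. Every main term is thus
  estimated in mean square, and s t <= (s^2 / a + a t^2) / 2, with a suitable a, takes the place of
  Cauchy-Schwarz for expectations. Under iteration the source term of a step is h |D2 b| |grad P^k
  f|, so the sup norm of the gradient has to be propagated along with its Lipschitz constant. The
  first estimate of (a) does this, because the sup norm of a gradient is a Lipschitz constant. The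
  product of \<open>D2_sup b\<close> and \<open>sup_norm (grad f)\<close> is kept as one quantity:
  it may vanish while a factor is infinite.\<close>

lemma filterlim_inverse_Suc_at_0:
  "filterlim (\<lambda>n. inverse (real (Suc n))) (at 0) sequentially"
  unfolding filterlim_at using LIMSEQ_inverse_real_of_nat by auto

text \<open>A sequence of increments, rather than a limit over the reals, is what measurability of
  limits and dominated convergence require.\<close>

lemma has_derivative_difference_quotient:
  fixes f :: "'a::real_normed_vector \<Rightarrow> real"
  assumes "(f has_derivative f') (at x)"
  shows "(\<lambda>n. (f (x + inverse (real (Suc n)) *\<^sub>R v) - f x) / inverse (real (Suc n))) \<longlonglongrightarrow> f' v"
proof -
  have "((\<lambda>t. f (x + t *\<^sub>R v)) has_derivative (\<lambda>t. f' (t *\<^sub>R v))) (at 0)"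
    by (rule has_derivative_compose[where g = f])
      (use assms in \<open>auto intro!: derivative_eq_intros\<close>)
  moreover have "(\<lambda>t. f' (t *\<^sub>R v)) = (*) (f' v)"
    using linear_cmul[OF has_derivative_linear[OF assms]] by (auto simp: fun_eq_iff mult.commute)
  ultimately have "((\<lambda>t. f (x + t *\<^sub>R v)) has_field_derivative f' v) (at 0)"
    by (simp add: has_field_derivative_def)
  then have "(\<lambda>t. (f (x + t *\<^sub>R v) - f x) / t) \<midarrow>0\<rightarrow> f' v"
    by (simp add: DERIV_def)
  from filterlim_compose[OF this filterlim_inverse_Suc_at_0] show ?thesis .
qed

text \<open>Only increments from the centre x are dominated, and nothing is asked of
  \<open>F'\<close> as a function of w. The difference quotients supply what is missing: they carry
  the bound \<open>K\<close> over to the derivative and make it measurable.\<close>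

lemma
  fixes F :: "'a::euclidean_space \<Rightarrow> 'w \<Rightarrow> real"
  assumes r: "r > 0"
    and int: "\<And>y. y \<in> ball x r \<Longrightarrow> integrable M (F y)"
    and deriv: "\<And>w. ((\<lambda>y. F y w) has_derivative F' w) (at x)"
    and K: "integrable M K"
    and bound: "\<And>y w. y \<in> ball x r \<Longrightarrow> \<bar>F y w - F x w\<bar> \<le> K w * norm (y - x)"
  shows integrable_derivative_dominated: "\<And>v. integrable M (\<lambda>w. F' w v)"
    and has_derivative_integral_dominated:
      "((\<lambda>y. \<integral>w. F y w \<partial>M) has_derivative (\<lambda>v. \<integral>w. F' w v \<partial>M)) (at x)"
proof -
  have lin: "linear (F' w)" for w
    using deriv has_derivative_linear by blast
  have ev: "eventually (\<lambda>n. x + inverse (real (Suc n)) *\<^sub>R v \<in> ball x r) sequentially" for v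
  proof -
    have "(\<lambda>n. x + inverse (real (Suc n)) *\<^sub>R v) \<longlonglongrightarrow> x + 0 *\<^sub>R v"
      by (intro tendsto_intros LIMSEQ_inverse_real_of_nat)
    then show ?thesis
      using r by (intro topological_tendstoD) auto
  qed
  have F'_bound: "\<bar>F' w v\<bar> \<le> K w * norm v" for w v
  proof (rule tendsto_upperbound)
    show "(\<lambda>n. \<bar>(F (x + inverse (real (Suc n)) *\<^sub>R v) w - F x w) / inverse (real (Suc n))\<bar>)
        \<longlonglongrightarrow> \<bar>F' w v\<bar>"
      by (intro tendsto_rabs has_derivative_difference_quotient deriv)
    show "\<forall>\<^sub>F n in sequentially. \<bar>(F (x + inverse (real (Suc n)) *\<^sub>R v) w - F x w) /
        inverse (real (Suc n))\<bar> \<le> K w * norm v"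
      using ev[of v]
    proof eventually_elim
      case (elim n)
      from bound[OF this, of w] show ?case
        by (simp add: divide_simps abs_mult mult_ac)
    qed
  qed simp
  have F'_meas: "(\<lambda>w. F' w v) \<in> borel_measurable M" for v
  proof -
    \<comment> \<open>\<open>F y\<close> is known to be measurable only for y in the ball, hence the
      shift by \<open>N\<close>.\<close>
    from ev[of v] obtain N where N: "\<And>n. n \<ge> N \<Longrightarrow> x + inverse (real (Suc n)) *\<^sub>R v \<in> ball x r"
      by (auto simp: eventually_sequentially)
    show ?thesis
    proof (rule borel_measurable_LIMSEQ_real)
      show "(\<lambda>n. (F (x + inverse (real (Suc (n + N))) *\<^sub>R v) w - F x w) / inverse (real (Suc (n + N))))
          \<longlonglongrightarrow> F' w v" for w
        by (rule LIMSEQ_ignore_initial_segment[OF has_derivative_difference_quotient[OF deriv]])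
      have [measurable]: "F x \<in> borel_measurable M"
        using int[of x] r by auto
      show "(\<lambda>w. (F (x + inverse (real (Suc (n + N))) *\<^sub>R v) w - F x w) / inverse (real (Suc (n + N))))
          \<in> borel_measurable M" for n
        using int[OF N[of "n + N"]] by (intro borel_measurable_divide borel_measurable_diff) auto
    qed
  qed
  show F'_int: "integrable M (\<lambda>w. F' w v)" for v
    by (rule Bochner_Integration.integrable_bound[of M "\<lambda>w. K w * norm v"])
      (use K F'_meas F'_bound in \<open>auto intro!: AE_I2 order_trans[OF _ abs_ge_self]\<close>)
  have lin_int: "linear (\<lambda>v. \<integral>w. F' w v \<partial>M)"
    by (rule linearI) (simp_all add: linear_add[OF lin] linear_cmul[OF lin] F'_int)
  show "((\<lambda>y. \<integral>w. F y w \<partial>M) has_derivative (\<lambda>v. \<integral>w. F' w v \<partial>M)) (at x)"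
    unfolding has_derivative_iff_norm
  proof
    show "bounded_linear (\<lambda>v. \<integral>w. F' w v \<partial>M)"
      using lin_int by (simp add: linear_conv_bounded_linear)
    show "((\<lambda>y. norm ((\<integral>w. F y w \<partial>M) - (\<integral>w. F x w \<partial>M) - (\<integral>w. F' w (y - x) \<partial>M)) / norm (y - x))
        \<longlongrightarrow> 0) (at x)"
      unfolding tendsto_at_iff_sequentially comp_def
    proof (intro allI impI)
      fix Y assume Y: "\<forall>i. Y i \<in> UNIV - {x}" and lim: "Y \<longlonglongrightarrow> x"
      have "eventually (\<lambda>n. Y n \<in> ball x r) sequentially"
        using r by (intro topological_tendstoD[OF lim]) auto
      then obtain N where N: "\<And>n. n \<ge> N \<Longrightarrow> Y n \<in> ball x r"
        by (auto simp: eventually_sequentially)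
      define R where "R n w = (F (Y (n + N)) w - F x w - F' w (Y (n + N) - x)) / norm (Y (n + N) - x)" for n w
      have int_R: "integrable M (R n)" for n
        unfolding R_def using int[OF N, of "n + N"] int[of x] r F'_int by auto
      have "(\<lambda>n. \<integral>w. R n w \<partial>M) \<longlonglongrightarrow> (\<integral>w. 0 \<partial>M)"
      proof (rule integral_dominated_convergence)
        show "AE w in M. (\<lambda>n. R n w) \<longlonglongrightarrow> 0"
        proof (rule AE_I2)
          fix w
          have "((\<lambda>y. norm (F y w - F x w - F' w (y - x)) / norm (y - x)) \<longlongrightarrow> 0) (at x)"
            using deriv[of w] by (simp add: has_derivative_iff_norm)
          with Y lim have "(\<lambda>n. norm (F (Y n) w - F x w - F' w (Y n - x)) / norm (Y n - x)) \<longlonglongrightarrow> 0"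
            unfolding tendsto_at_iff_sequentially comp_def by blast
          from LIMSEQ_ignore_initial_segment[OF this, of N]
          have "(\<lambda>n. norm (R n w)) \<longlonglongrightarrow> 0"
            by (simp add: R_def abs_divide)
          then show "(\<lambda>n. R n w) \<longlonglongrightarrow> 0"
            by (rule tendsto_norm_zero_cancel)
        qed
        \<comment> \<open>One \<open>K w\<close> pays for the increment of F, the other for its
          linear part.\<close>
        show "AE w in M. norm (R n w) \<le> 2 * K w" for n
        proof (rule AE_I2)
          fix w
          have "Y (n + N) \<noteq> x" using Y by auto
          moreover have "\<bar>F (Y (n + N)) w - F x w - F' w (Y (n + N) - x)\<bar> \<le> 2 * (K w * norm (Y (n + N) - x))"
            using bound[OF N, of "n + N" w] F'_bound[of w "Y (n + N) - x"] by auto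
          ultimately show "norm (R n w) \<le> 2 * K w"
            by (simp add: R_def abs_divide divide_simps mult_ac)
        qed
        show "integrable M (\<lambda>w. 2 * K w)" using K by simp
        show "R n \<in> borel_measurable M" for n using int_R by auto
      qed simp
      moreover have "(\<integral>w. R n w \<partial>M) = ((\<integral>w. F (Y (n + N)) w \<partial>M) - (\<integral>w. F x w \<partial>M)
          - (\<integral>w. F' w (Y (n + N) - x) \<partial>M)) / norm (Y (n + N) - x)" for n
        unfolding R_def using int[OF N, of "n + N"] int[of x] r F'_int by simp
      ultimately have "(\<lambda>n. norm (((\<integral>w. F (Y (n + N)) w \<partial>M) - (\<integral>w. F x w \<partial>M)
          - (\<integral>w. F' w (Y (n + N) - x) \<partial>M)) / norm (Y (n + N) - x))) \<longlonglongrightarrow> 0"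
        by (intro tendsto_norm_zero) simp
      then have "(\<lambda>n. norm ((\<integral>w. F (Y (n + N)) w \<partial>M) - (\<integral>w. F x w \<partial>M)
          - (\<integral>w. F' w (Y (n + N) - x) \<partial>M)) / norm (Y (n + N) - x)) \<longlonglongrightarrow> 0"
        by (simp add: abs_divide)
      then show "(\<lambda>n. norm ((\<integral>w. F (Y n) w \<partial>M) - (\<integral>w. F x w \<partial>M)
          - (\<integral>w. F' w (Y n - x) \<partial>M)) / norm (Y n - x)) \<longlonglongrightarrow> 0"
        by (rule LIMSEQ_offset)
    qed
  qed
qed

section \<open>Inequalities for integrals, matrices and gradients\<close>

lemma abs_integral_le:
  fixes f g :: "'w \<Rightarrow> real"
  assumes "integrable M f" "integrable M g" "\<And>x. \<bar>f x\<bar> \<le> g x"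
  shows "\<bar>\<integral>x. f x \<partial>M\<bar> \<le> (\<integral>x. g x \<partial>M)"
  by (rule order_trans[OF integral_abs_bound integral_mono]) (use assms in auto)

text \<open>The norm of an element of \<open>real^'n^'m\<close> is the Frobenius norm, so
  Cauchy-Schwarz on each row suffices.\<close>

lemma norm_matrix_vector_mult_le:
  fixes A :: "real^'n::finite^'m::finite"
  shows "norm (A *v x) \<le> norm A * norm x"
proof -
  have "norm (A *v x) = L2_set (\<lambda>i. \<bar>inner (A $ i) x\<bar>) UNIV"
    by (simp add: norm_vec_def matrix_vector_mul_component)
  also have "\<dots> \<le> L2_set (\<lambda>i. norm (A $ i) * norm x) UNIV"
    by (intro L2_set_mono) (auto simp: Cauchy_Schwarz_ineq2)
  also have "\<dots> = norm A * norm x"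
    by (simp add: norm_vec_def L2_set_left_distrib)
  finally show ?thesis .
qed

lemma has_derivative_grad:
  assumes "f differentiable (at x)"
  shows "(f has_derivative (\<lambda>v. grad f x \<bullet> v)) (at x)"
proof -
  let ?f' = "frechet_derivative f (at x)"
  have d: "(f has_derivative ?f') (at x)"
    using assms by (simp add: frechet_derivative_works)
  have lin: "linear ?f'"
    using d has_derivative_linear by blast
  have "?f' v = grad f x \<bullet> v" for v
  proof -
    have "?f' v = ?f' (\<Sum>i\<in>UNIV. (v $ i) *\<^sub>R axis i 1)"
      using basis_expansion[of v] by (simp add: scalar_mult_eq_scaleR)
    also have "\<dots> = (\<Sum>i\<in>UNIV. v $ i * ?f' (axis i 1))"
      by (simp add: linear_sum[OF lin] linear_cmul[OF lin])
    finally show ?thesis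
      by (simp add: grad_def inner_vec_def mult.commute)
  qed
  then have "?f' = (\<lambda>v. grad f x \<bullet> v)" by auto
  with d show ?thesis by simp
qed

lemma grad_inner_eq:
  assumes "(f has_derivative f') (at x)"
  shows "grad f x \<bullet> v = f' v"
proof -
  have "f differentiable (at x)"
    using assms differentiable_def by blast
  from has_derivative_unique[OF has_derivative_grad[OF this] assms] show ?thesis
    by metis
qed

lemma has_derivative_D1:
  assumes "g differentiable (at x)"
  shows "(g has_derivative blinfun_apply (D1 g x)) (at x)"
  using assms unfolding D1_def frechet_derivative_works
  by (simp add: bounded_linear_Blinfun_apply has_derivative_bounded_linear)

lemma twice_differentiable_D1:
  "twice_differentiable g \<Longrightarrow> (g has_derivative blinfun_apply (D1 g x)) (at x)"
  by (simp add: twice_differentiable_def has_derivative_D1)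

lemma twice_differentiable_D2:
  "twice_differentiable g \<Longrightarrow> (D1 g has_derivative blinfun_apply (D2 g x)) (at x)"
  by (simp add: twice_differentiable_def D2_def has_derivative_D1)

text \<open>Differentiability at the single point x controls increments that start at x, though not
  those between two nearby points. This is exactly the form of domination needed to differentiate an
  integral at x.\<close>

lemma has_derivative_locally_Lipschitz:
  assumes "(g has_derivative g') (at x)"
  obtains r B where "r > 0" "B \<ge> 0" "\<And>y. y \<in> ball x r \<Longrightarrow> norm (g y - g x) \<le> B * norm (y - x)"
proof -
  have bl: "bounded_linear g'" using assms has_derivative_bounded_linear by blast
  from assms obtain d where d: "d > 0"
    "\<And>y. norm (y - x) < d \<Longrightarrow> norm (g y - g x - g' (y - x)) \<le> 1 * norm (y - x)"
    unfolding has_derivative_at_alt by (metis zero_less_one)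
  have "norm (g y - g x) \<le> (1 + onorm g') * norm (y - x)" if "y \<in> ball x d" for y
  proof -
    have "norm (g y - g x) \<le> norm (g y - g x - g' (y - x)) + norm (g' (y - x))"
      by (metis diff_add_cancel norm_triangle_ineq)
    also have "\<dots> \<le> norm (y - x) + onorm g' * norm (y - x)"
      using d(2)[of y] that onorm[OF bl, of "y - x"]
      by (intro add_mono) (auto simp: dist_norm norm_minus_commute[of x y])
    finally show ?thesis by (simp add: algebra_simps)
  qed
  with d(1) onorm_pos_le[OF bl] show ?thesis
    by (intro that[of d "1 + onorm g'"]) auto
qed

text \<open>Pairing g with the vector \<open>g' v\<close> itself reduces the bound to real
  difference quotients.\<close>

lemma has_derivative_norm_le_Lipschitz:
  fixes g :: "'a::real_normed_vector \<Rightarrow> 'b::real_inner"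
  assumes deriv: "(g has_derivative g') (at x)"
    and lip: "\<And>y. norm (g y - g x) \<le> L * norm (y - x)"
  shows "norm (g' v) \<le> L * norm v"
proof -
  let ?e = "g' v"
  have "((\<lambda>y. g y \<bullet> ?e) has_derivative (\<lambda>u. g' u \<bullet> ?e)) (at x)"
    using deriv by (auto intro!: derivative_eq_intros)
  from has_derivative_difference_quotient[OF this, of v]
  have "?e \<bullet> ?e \<le> L * norm v * norm ?e"
  proof (rule tendsto_upperbound)
    show "\<forall>\<^sub>F n in sequentially. (g (x + inverse (real (Suc n)) *\<^sub>R v) \<bullet> ?e - g x \<bullet> ?e) /
        inverse (real (Suc n)) \<le> L * norm v * norm ?e"
    proof (rule always_eventually, rule allI)
      fix n
      let ?t = "inverse (real (Suc n))"
      have "g (x + ?t *\<^sub>R v) \<bullet> ?e - g x \<bullet> ?e \<le> norm (g (x + ?t *\<^sub>R v) - g x) * norm ?e"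
        by (metis inner_diff_left norm_cauchy_schwarz)
      also have "\<dots> \<le> (L * norm (?t *\<^sub>R v)) * norm ?e"
        using lip[of "x + ?t *\<^sub>R v"] by (intro mult_right_mono) auto
      also have "\<dots> = ?t * (L * norm v * norm ?e)"
        by (simp add: mult_ac)
      finally show "(g (x + ?t *\<^sub>R v) \<bullet> ?e - g x \<bullet> ?e) / ?t \<le> L * norm v * norm ?e"
        by (subst pos_divide_le_eq) (auto simp: mult_ac)
    qed
  qed simp
  then have "norm ?e * norm ?e \<le> (L * norm v) * norm ?e"
    by (simp add: dot_square_norm power2_eq_square)
  moreover have "0 \<le> L * norm v"
    using order_trans[OF norm_ge_zero lip[of "x + v"]] by simp
  ultimately show ?thesis
    by (cases "norm ?e = 0") (auto simp: mult_le_cancel_right)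
qed

lemma norm_diff_le_of_D1_bound:
  assumes "\<And>x. (g has_derivative blinfun_apply (D1 g x)) (at x)" "\<And>x. norm (D1 g x) \<le> K"
  shows "norm (g y - g x) \<le> K * norm (y - x)"
  by (rule differentiable_bound[of UNIV g "\<lambda>x. blinfun_apply (D1 g x)"])
    (use assms in \<open>auto simp: norm_blinfun.rep_eq\<close>)

section \<open>Gaussian integration by parts\<close>


definition gauss_density :: "real^'q::finite \<Rightarrow> real"
  where "gauss_density z = (\<Prod>i\<in>UNIV. std_normal_density (z $ i))"

lemma gauss_density_nonneg [simp]: "0 \<le> gauss_density z"
  by (simp add: gauss_density_def prod_nonneg)

lemma measurable_gauss_density [measurable]: "gauss_density \<in> borel_measurable borel"
  unfolding gauss_density_def by measurable

lemma std_gaussian_density: "std_gaussian = density lborel (\<lambda>z. ennreal (gauss_density z))"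
  by (simp add: std_gaussian_def gauss_density_def)

lemma gauss_density_eq:
  fixes z :: "real^'q::finite"
  shows "gauss_density z = (1 / sqrt (2 * pi)) ^ CARD('q) * exp (- (norm z)\<^sup>2 / 2)"
proof -
  have "(\<Sum>i\<in>UNIV. - (z $ i)\<^sup>2 / 2) = - (norm z)\<^sup>2 / 2"
    by (simp add: norm_vec_def L2_set_def sum_nonneg sum_negf sum_divide_distrib)
  then have "(\<Prod>i\<in>UNIV. exp (- (z $ i)\<^sup>2 / 2)) = exp (- (norm z)\<^sup>2 / 2)"
    by (metis exp_sum finite)
  then show ?thesis
    by (simp add: gauss_density_def std_normal_density_def prod.distrib prod_dividef power_divide)
qed

lemma sets_std_gaussian [measurable_cong, simp]: "sets std_gaussian = sets borel"
  by (simp add: std_gaussian_def)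

lemma space_std_gaussian [simp]: "space std_gaussian = UNIV"
  by (simp add: std_gaussian_def)

lemma nn_integral_lborel_prod_vec:
  fixes f :: "real \<Rightarrow> ennreal"
  assumes [measurable]: "f \<in> borel_measurable borel"
  shows "(\<integral>\<^sup>+z. (\<Prod>i\<in>UNIV. f (z $ i)) \<partial>(lborel :: (real^'q::finite) measure)) =
    (\<integral>\<^sup>+s. f s \<partial>lborel) ^ CARD('q)"
proof -
  have B: "(Basis :: (real^'q) set) = (\<lambda>i. axis i 1) ` UNIV"
    by (auto simp: Basis_vec_def)
  have inj: "inj (\<lambda>i::'q. axis i (1::real))"
    by (auto simp: inj_def axis_eq_axis)
  have "(\<integral>\<^sup>+z. (\<Prod>b\<in>Basis. f (z \<bullet> b)) \<partial>(lborel :: (real^'q::finite) measure)) =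
      (\<Prod>b\<in>(Basis :: (real^'q) set). (\<integral>\<^sup>+s. f s \<partial>lborel))"
    by (rule nn_integral_lborel_prod) auto
  then show ?thesis
    unfolding B prod.reindex[OF inj] by (simp add: inner_axis)
qed

lemma nn_integral_std_gaussian_prod:
  fixes f :: "real \<Rightarrow> real"
  assumes [measurable]: "f \<in> borel_measurable borel" and "\<And>s. 0 \<le> f s"
  shows "(\<integral>\<^sup>+z. ennreal (\<Prod>i\<in>UNIV. f (z $ i)) \<partial>(std_gaussian :: (real^'q::finite) measure)) =
    (\<integral>\<^sup>+s. ennreal (std_normal_density s * f s) \<partial>lborel) ^ CARD('q)"
proof -
  have "(\<integral>\<^sup>+z. ennreal (\<Prod>i\<in>UNIV. f (z $ i)) \<partial>(std_gaussian :: (real^'q) measure)) =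
      (\<integral>\<^sup>+z. (\<Prod>i\<in>UNIV. ennreal (std_normal_density (z $ i) * f (z $ i))) \<partial>(lborel :: (real^'q) measure))"
    unfolding std_gaussian_def using assms
    by (subst nn_integral_density)
      (auto intro!: nn_integral_cong simp: prod_ennreal prod.distrib prod_nonneg ennreal_mult'[symmetric])
  also have "\<dots> = (\<integral>\<^sup>+s. ennreal (std_normal_density s * f s) \<partial>lborel) ^ CARD('q)"
    by (rule nn_integral_lborel_prod_vec) measurable
  finally show ?thesis .
qed

interpretation std_gaussian: prob_space "std_gaussian :: (real^'q::finite) measure"
proof
  have "(\<integral>\<^sup>+s. ennreal (std_normal_density s) \<partial>lborel) = 1"
    by (subst nn_integral_eq_integral) auto
  then show "emeasure (std_gaussian :: (real^'q) measure) (space std_gaussian) = 1"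
    using nn_integral_std_gaussian_prod[where 'q='q, of "\<lambda>_. 1"] by simp
qed

text \<open>Against the standard density the factor exp(s^2 / 4) leaves exp(-s^2 / 4), a multiple of
  the normal density of variance 2. All exponential moments of |z| follow by completing the
  square.\<close>

lemma integrable_std_gaussian_exp_square:
  "integrable (std_gaussian :: (real^'q::finite) measure) (\<lambda>z. exp ((norm z)\<^sup>2 / 4))"
proof (rule integrableI_bounded)
  have eq: "std_normal_density s * exp (s\<^sup>2 / 4) = sqrt 2 * normal_density 0 (sqrt 2) s" for s :: real
    by (simp add: normal_density_def real_sqrt_mult exp_add[symmetric] field_simps)
  have "(\<integral>\<^sup>+s. ennreal (std_normal_density s * exp (s\<^sup>2 / 4)) \<partial>lborel) < \<infinity>"
    unfolding eq by (subst nn_integral_eq_integral) auto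
  then have "(\<integral>\<^sup>+z. ennreal (\<Prod>i\<in>UNIV. exp ((z $ i)\<^sup>2 / 4)) \<partial>(std_gaussian :: (real^'q) measure)) < \<infinity>"
    by (subst nn_integral_std_gaussian_prod) (auto simp: power_less_top_ennreal)
  moreover have "(\<Prod>i\<in>UNIV. exp ((z $ i)\<^sup>2 / 4)) = exp ((norm z)\<^sup>2 / 4)" for z :: "real^'q"
    by (simp add: exp_sum[symmetric] norm_vec_def L2_set_def sum_nonneg sum_divide_distrib)
  ultimately show "(\<integral>\<^sup>+z. ennreal (norm (exp ((norm z)\<^sup>2 / 4))) \<partial>(std_gaussian :: (real^'q) measure)) < \<infinity>"
    by simp
qed measurable

lemma integrable_std_gaussian_exp_norm:
  "integrable (std_gaussian :: (real^'q::finite) measure) (\<lambda>z. exp (r * norm z))"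
proof (rule Bochner_Integration.integrable_bound)
  show "integrable (std_gaussian :: (real^'q) measure) (\<lambda>z. exp (r\<^sup>2) * exp ((norm z)\<^sup>2 / 4))"
    using integrable_std_gaussian_exp_square by simp
  have "r * t \<le> r\<^sup>2 + t\<^sup>2 / 4" for t :: real
    using zero_le_power2[of "r - t / 2"] by (simp add: power2_eq_square algebra_simps)
  then show "AE z in (std_gaussian :: (real^'q) measure). norm (exp (r * norm z)) \<le> norm (exp (r\<^sup>2) * exp ((norm z)\<^sup>2 / 4))"
    by (simp add: exp_add[symmetric])
qed measurable

lemma integrable_std_gaussian_of_bound:
  fixes G :: "real^'q::finite \<Rightarrow> real"
  assumes [measurable]: "G \<in> borel_measurable borel" and "\<And>z. \<bar>G z\<bar> \<le> C * exp (r * norm z)"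
  shows "integrable std_gaussian G"
proof (rule Bochner_Integration.integrable_bound)
  show "integrable (std_gaussian :: (real^'q) measure) (\<lambda>z. C * exp (r * norm z))"
    by (intro integrable_mult_right integrable_std_gaussian_exp_norm)
  show "AE z in std_gaussian. norm (G z) \<le> norm (C * exp (r * norm z))"
    using assms(2) by (auto intro!: AE_I2 intro: order_trans[OF _ abs_ge_self])
qed measurable

lemma le_exp_self: "(t::real) \<le> exp t"
  using exp_ge_add_one_self[of t] by linarith

lemma integrable_std_gaussian_norm_square:
  "integrable (std_gaussian :: (real^'q::finite) measure) (\<lambda>z. (norm z)\<^sup>2)"
proof (rule integrable_std_gaussian_of_bound[of _ 1 2])
  fix z :: "real^'q"
  have "(norm z)\<^sup>2 \<le> (exp (norm z))\<^sup>2"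
    by (intro power_mono le_exp_self) auto
  also have "\<dots> = exp (2 * norm z)"
    by (simp add: exp_of_nat_mult[symmetric] power2_eq_square exp_add[symmetric])
  finally show "\<bar>(norm z)\<^sup>2\<bar> \<le> 1 * exp (2 * norm z)" by simp
qed measurable

text \<open>Cameron-Martin formula: the weight is the quotient of the shifted density by the
  original one. It moves a perturbation of the argument of G onto a smooth factor.\<close>

lemma integral_std_gaussian_translate:
  fixes G :: "real^'q::finite \<Rightarrow> real"
  assumes [measurable]: "G \<in> borel_measurable borel"
  shows "(\<integral>z. G (z + u) \<partial>std_gaussian) = (\<integral>z. exp (u \<bullet> z - (norm u)\<^sup>2 / 2) * G z \<partial>std_gaussian)"
proof -
  have dens: "gauss_density (z - u) = gauss_density z * exp (u \<bullet> z - (norm u)\<^sup>2 / 2)" for z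
  proof -
    have "- (norm (z - u))\<^sup>2 / 2 = - (norm z)\<^sup>2 / 2 + (u \<bullet> z - (norm u)\<^sup>2 / 2)"
      by (simp add: power2_norm_eq_inner inner_diff inner_commute field_simps)
    then show ?thesis
      by (simp only: gauss_density_eq exp_add mult.assoc)
  qed
  have "(\<integral>z. G (z + u) \<partial>std_gaussian) = (\<integral>z. gauss_density z * G (z + u) \<partial>lborel)"
    unfolding std_gaussian_density by (subst integral_density) auto
  also have "\<dots> = (\<integral>z. gauss_density ((u + z) - u) * G (u + z) \<partial>lborel)"
    by (simp add: add.commute)
  also have "\<dots> = (\<integral>z. gauss_density (z - u) * G z \<partial>distr lborel borel ((+) u))"
    by (subst integral_distr) auto
  also have "\<dots> = (\<integral>z. gauss_density z * (exp (u \<bullet> z - (norm u)\<^sup>2 / 2) * G z) \<partial>lborel)"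
    by (simp add: lborel_distr_plus dens mult.assoc)
  also have "\<dots> = (\<integral>z. exp (u \<bullet> z - (norm u)\<^sup>2 / 2) * G z \<partial>std_gaussian)"
    unfolding std_gaussian_density by (subst integral_density) auto
  finally show ?thesis .
qed

lemma abs_exp_minus_one_le: "\<bar>exp a - 1\<bar> \<le> \<bar>a\<bar> * exp \<bar>a\<bar>" for a :: real
proof (cases "a \<ge> 0")
  case True
  have "(1 - a) * exp a \<le> exp (- a) * exp a"
    using exp_ge_add_one_self[of "- a"] by (intro mult_right_mono) auto
  with True show ?thesis by (simp add: algebra_simps exp_minus_inverse)
next
  case False
  have "1 + a \<le> exp a" "exp a \<le> 1"
    using False exp_ge_add_one_self[of a] by auto
  then have "\<bar>exp a - 1\<bar> \<le> \<bar>a\<bar> * 1"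
    by linarith
  also have "\<dots> \<le> \<bar>a\<bar> * exp \<bar>a\<bar>"
    by (intro mult_left_mono) auto
  finally show ?thesis .
qed

text \<open>The translation formula is differentiated at u = 0 in direction w. On one side this
  differentiates G, on the other the weight, whose derivative at 0 is w . z. Dominated convergence
  handles both sides, so \<open>G'\<close> need not be continuous.\<close>

lemma
  fixes G :: "real^'q::finite \<Rightarrow> real"
  assumes lip: "L-lipschitz_on UNIV G"
    and deriv: "\<And>z. (G has_derivative G' z) (at z)"
  shows integrable_std_gaussian_derivative: "integrable std_gaussian (\<lambda>z. G' z w)"
    and std_gaussian_integration_by_parts:
      "(\<integral>z. (w \<bullet> z) * G z \<partial>std_gaussian) = (\<integral>z. G' z w \<partial>std_gaussian)"
proof -
  have L: "0 \<le> L" using lip lipschitz_on_nonneg by blast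
  have [measurable]: "G \<in> borel_measurable borel"
    by (rule borel_measurable_continuous_onI[OF lipschitz_on_continuous_on[OF lip]])
  have lipn: "\<bar>G y - G z\<bar> \<le> L * norm (y - z)" for y z
    using lipschitz_onD[OF lip, of y z] by (simp add: dist_norm)
  define c where "c = \<bar>G 0\<bar> + L"
  have c: "0 \<le> c" using L by (simp add: c_def)
  have G_bound: "\<bar>G z\<bar> \<le> c * exp (norm z)" for z
  proof -
    have "\<bar>G z\<bar> \<le> \<bar>G 0\<bar> * 1 + L * norm z" using lipn[of z 0] by simp
    also have "\<dots> \<le> \<bar>G 0\<bar> * exp (norm z) + L * exp (norm z)"
      using L le_exp_self by (intro add_mono mult_left_mono) auto
    finally show ?thesis by (simp add: c_def algebra_simps)
  qed
  define e where "e n = inverse (real (Suc n))" for n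
  have e: "0 < e n" "e n \<le> 1" for n
    by (auto simp: e_def inverse_le_1_iff)
  define a where "a n z = (e n *\<^sub>R w) \<bullet> z - (norm (e n *\<^sub>R w))\<^sup>2 / 2" for n z
  \<comment> \<open>\<open>s\<close> is the difference quotient of G and \<open>t\<close> that of
    the Cameron-Martin weight, multiplied by G; the translation formula gives them equal
    integrals.\<close>
  define s where "s n z = (G (z + e n *\<^sub>R w) - G z) / e n" for n z
  define t where "t n z = (exp (a n z) - 1) / e n * G z" for n z
  define R where "R = norm w + (norm w)\<^sup>2"
  have R: "0 \<le> R" by (simp add: R_def)
  have [measurable]: "a n \<in> borel_measurable borel" for n
    unfolding a_def by measurable
  have a_bound: "\<bar>a n z\<bar> \<le> e n * (R * (1 + norm z))" for n z
  proof -
    have "\<bar>a n z\<bar> \<le> \<bar>(e n *\<^sub>R w) \<bullet> z\<bar> + \<bar>(norm (e n *\<^sub>R w))\<^sup>2 / 2\<bar>"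
      unfolding a_def by (rule abs_triangle_ineq4)
    also have "\<dots> \<le> e n * (norm w * norm z) + e n * (norm w)\<^sup>2"
    proof (rule add_mono)
      show "\<bar>(e n *\<^sub>R w) \<bullet> z\<bar> \<le> e n * (norm w * norm z)"
        using e(1)[of n] Cauchy_Schwarz_ineq2[of w z] by (simp add: abs_mult)
      have "(e n)\<^sup>2 * (norm w)\<^sup>2 / 2 \<le> (e n)\<^sup>2 * (norm w)\<^sup>2"
        by simp
      also have "\<dots> \<le> e n * (norm w)\<^sup>2"
        using e[of n] by (intro mult_right_mono) (auto simp: power2_eq_square mult_le_cancel_left1)
      finally show "\<bar>(norm (e n *\<^sub>R w))\<^sup>2 / 2\<bar> \<le> e n * (norm w)\<^sup>2"
        by (simp add: power_mult_distrib)
    qed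
    also have "\<dots> \<le> e n * (R * (1 + norm z))"
      using e(1)[of n] by (simp add: R_def algebra_simps)
    finally show ?thesis .
  qed
  have a_bound': "\<bar>a n z\<bar> \<le> R * (1 + norm z)" for n z
    using a_bound[of n z] mult_right_mono[OF e(2)[of n], of "R * (1 + norm z)"] R by simp
  \<comment> \<open>The factor \<open>e n\<close> in the bound on \<open>a n z\<close> cancels the
    division, which makes the bound uniform in n. The exponent R + 2 collects R from the weight and
    1 each from 1 + |z| and from the growth of G.\<close>
  have t_bound: "\<bar>t n z\<bar> \<le> c * R * exp R * exp ((R + 2) * norm z)" for n z
  proof -
    have "\<bar>exp (a n z) - 1\<bar> \<le> \<bar>a n z\<bar> * exp \<bar>a n z\<bar>"
      by (rule abs_exp_minus_one_le)
    also have "\<dots> \<le> (e n * (R * (1 + norm z))) * exp (R * (1 + norm z))"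
      using a_bound a_bound' e(1)[of n] R by (intro mult_mono) auto
    also have "\<dots> \<le> (e n * (R * exp (norm z))) * exp (R * (1 + norm z))"
      using e(1)[of n] R by (intro mult_right_mono mult_left_mono) (auto simp: exp_ge_add_one_self)
    finally have "\<bar>exp (a n z) - 1\<bar> / e n \<le> R * exp (norm z) * exp (R * (1 + norm z))"
      using e(1)[of n] by (subst pos_divide_le_eq) (auto simp: mult_ac)
    then have "\<bar>t n z\<bar> \<le> (R * exp (norm z) * exp (R * (1 + norm z))) * (c * exp (norm z))"
      unfolding t_def using e(1)[of n] R G_bound[of z]
      by (simp only: abs_mult abs_divide) (intro mult_mono, auto)
    also have "\<dots> = c * R * (exp (norm z) * exp (norm z) * exp (R * (1 + norm z)))"
      by simp
    also have "\<dots> = c * R * (exp R * exp ((R + 2) * norm z))"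
      by (simp add: exp_add[symmetric] algebra_simps)
    finally show ?thesis by (simp add: mult_ac)
  qed
  have int_t: "integrable std_gaussian (t n)" for n
    by (rule integrable_std_gaussian_of_bound[OF _ t_bound]) (unfold t_def, measurable)
  have int_G: "integrable std_gaussian G"
    by (rule integrable_std_gaussian_of_bound[of _ c 1]) (use G_bound in auto)
  have int_Gs: "integrable std_gaussian (\<lambda>z. G (z + u))" for u
  proof (rule integrable_std_gaussian_of_bound[of _ "c * exp (norm u)" 1])
    fix z
    have "\<bar>G (z + u)\<bar> \<le> c * exp (norm (z + u))" by (rule G_bound)
    also have "\<dots> \<le> c * exp (norm u + norm z)"
      using c norm_triangle_ineq[of z u] by (intro mult_left_mono) auto
    finally show "\<bar>G (z + u)\<bar> \<le> c * exp (norm u) * exp (1 * norm z)"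
      by (simp add: exp_add)
  qed measurable
  have s_eq_t: "(\<integral>z. s n z \<partial>std_gaussian) = (\<integral>z. t n z \<partial>std_gaussian)" for n
  proof -
    have "(\<integral>z. G (z + e n *\<^sub>R w) \<partial>std_gaussian) = (\<integral>z. exp (a n z) * G z \<partial>std_gaussian)"
      unfolding a_def by (rule integral_std_gaussian_translate) measurable
    also have "\<dots> = (\<integral>z. e n * t n z + G z \<partial>std_gaussian)"
      using e(1)[of n] by (intro Bochner_Integration.integral_cong) (auto simp: t_def field_simps)
    also have "\<dots> = e n * (\<integral>z. t n z \<partial>std_gaussian) + (\<integral>z. G z \<partial>std_gaussian)"
      using int_t int_G by simp
    finally show ?thesis
      unfolding s_def integral_divide_zero Bochner_Integration.integral_diff[OF int_Gs int_G]
      using e(1)[of n] by simp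
  qed
  have s_lim: "(\<lambda>n. s n z) \<longlonglongrightarrow> G' z w" for z
    unfolding s_def e_def by (rule has_derivative_difference_quotient[OF deriv])
  have s_bound: "norm (s n z) \<le> L * norm w" for n z
    using lipn[of "z + e n *\<^sub>R w" z] e(1)[of n] by (simp add: s_def divide_simps mult_ac)
  have [measurable]: "s n \<in> borel_measurable borel" for n
    unfolding s_def by measurable
  have [measurable]: "t n \<in> borel_measurable borel" for n
    unfolding t_def by measurable
  have [measurable]: "(\<lambda>z. G' z w) \<in> borel_measurable borel"
    by (rule borel_measurable_LIMSEQ_real[of _ s]) (use s_lim in auto)
  have s_conv: "(\<lambda>n. \<integral>z. s n z \<partial>std_gaussian) \<longlonglongrightarrow> (\<integral>z. G' z w \<partial>std_gaussian)"
    by (rule integral_dominated_convergence[where w = "\<lambda>_. L * norm w"])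
      (use s_lim s_bound in auto)
  show "integrable std_gaussian (\<lambda>z. G' z w)"
    by (rule integrable_dominated_convergence[where w = "\<lambda>_. L * norm w" and s = s])
      (use s_lim s_bound in auto)
  have t_lim: "(\<lambda>n. t n z) \<longlonglongrightarrow> (w \<bullet> z) * G z" for z
  proof -
    \<comment> \<open>The quadratic part of the exponent has derivative 0 at r = 0, so only w . z
      survives.\<close>
    have "((\<lambda>r. exp ((r *\<^sub>R w) \<bullet> z - (norm (r *\<^sub>R w))\<^sup>2 / 2)) has_derivative (\<lambda>r. r * (w \<bullet> z))) (at 0)"
      by (auto intro!: derivative_eq_intros simp: power_mult_distrib)
    from has_derivative_difference_quotient[OF this, of 1]
    have "(\<lambda>n. (exp (a n z) - 1) / e n) \<longlonglongrightarrow> w \<bullet> z"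
      by (simp add: a_def e_def)
    then show ?thesis unfolding t_def by (intro tendsto_mult) auto
  qed
  have "(\<lambda>n. \<integral>z. t n z \<partial>std_gaussian) \<longlonglongrightarrow> (\<integral>z. (w \<bullet> z) * G z \<partial>std_gaussian)"
    by (rule integral_dominated_convergence[where w = "\<lambda>z. c * R * exp R * exp ((R + 2) * norm z)"])
      (use t_lim t_bound integrable_std_gaussian_exp_norm in auto)
  with s_conv show "(\<integral>z. (w \<bullet> z) * G z \<partial>std_gaussian) = (\<integral>z. G' z w \<partial>std_gaussian)"
    unfolding s_eq_t by (rule LIMSEQ_unique[rotated])
qed

section \<open>Moments and cancellation for the noise\<close>


lemma prob_std_gaussian [simp]: "measure std_gaussian UNIV = 1"
  using std_gaussian.prob_space by simp

lemma std_gaussian_linear_form: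
  "integrable (std_gaussian :: (real^'q::finite) measure) (\<lambda>z. w \<bullet> z)"
  "(\<integral>z. w \<bullet> z \<partial>(std_gaussian :: (real^'q) measure)) = 0"
proof -
  show "integrable (std_gaussian :: (real^'q) measure) (\<lambda>z. w \<bullet> z)"
  proof (rule integrable_std_gaussian_of_bound[of _ "norm w" 1])
    fix z :: "real^'q"
    have "\<bar>w \<bullet> z\<bar> \<le> norm w * norm z" by (rule Cauchy_Schwarz_ineq2)
    also have "\<dots> \<le> norm w * exp (1 * norm z)"
      using le_exp_self by (intro mult_left_mono) auto
    finally show "\<bar>w \<bullet> z\<bar> \<le> norm w * exp (1 * norm z)" .
  qed measurable
  \<comment> \<open>Integration by parts against the constant 1 shows that the Gaussian is
    centred.\<close>
  have "0-lipschitz_on UNIV (\<lambda>z::real^'q. 1::real)"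
    by (rule lipschitz_onI) auto
  from std_gaussian_integration_by_parts[OF this, of "\<lambda>_ _. 0" w]
  show "(\<integral>z. w \<bullet> z \<partial>(std_gaussian :: (real^'q) measure)) = 0"
    by simp
qed

text \<open>Stein's identity in the form of a bound by the entries of \<open>A S\<^sup>T\<close> alone: the two matrices
  enter only through this product, which is what makes the hypothesis on \<open>(D\<^sup>2\<sigma>)\<sigma>\<^sup>*\<close> usable.\<close>

lemma std_gaussian_Stein_bound:
  fixes g :: "real^'d::finite \<Rightarrow> real^'d" and A S :: "real^'q::finite^'d"
  assumes lip: "L-lipschitz_on UNIV g" and diff: "\<And>x. g differentiable (at x)"
  shows "\<bar>\<integral>z. g (a + S *v z) \<bullet> (A *v z) \<partial>std_gaussian\<bar> \<le> L * (\<Sum>k\<in>UNIV. \<Sum>m\<in>UNIV. \<bar>(A ** transpose S) $ k $ m\<bar>)"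
proof -
  define g' where "g' p = frechet_derivative g (at p)" for p
  have g': "(g has_derivative g' p) (at p)" for p
    unfolding g'_def using diff frechet_derivative_works by blast
  have lin: "linear (g' p)" for p
    using g' has_derivative_linear by blast
  have L: "0 \<le> L" using lip lipschitz_on_nonneg by blast
  have lipn: "norm (g y - g x) \<le> L * norm (y - x)" for x y
    using lipschitz_onD[OF lip, of y x] by (simp add: dist_norm)
  have g'_le: "norm (g' p v) \<le> L * norm v" for p v
    by (rule has_derivative_norm_le_Lipschitz[OF g' lipn])
  \<comment> \<open>\<open>A *v axis l 1\<close> is the l-th column of A. Expanding A z in its
    columns leaves one integration by parts for each coordinate of z.\<close>
  define G where "G l z = g (a + S *v z) \<bullet> (A *v axis l 1)" for l z
  define G' where "G' l z v = g' (a + S *v z) (S *v v) \<bullet> (A *v axis l 1)" for l z v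
  have dG: "(G l has_derivative G' l z) (at z)" for l z
    unfolding G_def G'_def
    by (auto intro!: derivative_eq_intros has_derivative_compose[OF _ g'] bounded_linear_imp_has_derivative)
  have lipG: "(L * norm S * norm (A *v axis l 1))-lipschitz_on UNIV (G l)" for l
  proof (rule lipschitz_onI)
    fix y z :: "real^'q"
    have "\<bar>G l y - G l z\<bar> \<le> norm (g (a + S *v y) - g (a + S *v z)) * norm (A *v axis l 1)"
      unfolding G_def inner_diff_left[symmetric] by (rule Cauchy_Schwarz_ineq2)
    also have "\<dots> \<le> (L * norm (S *v (y - z))) * norm (A *v axis l 1)"
      using lipn[of "a + S *v y" "a + S *v z"]
      by (intro mult_right_mono) (auto simp: matrix_vector_mult_diff_distrib)
    also have "\<dots> \<le> (L * (norm S * norm (y - z))) * norm (A *v axis l 1)"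
      using L by (intro mult_right_mono mult_left_mono norm_matrix_vector_mult_le) auto
    finally show "dist (G l y) (G l z) \<le> L * norm S * norm (A *v axis l 1) * dist y z"
      by (simp add: dist_norm mult_ac)
  qed (use L in auto)
  have [measurable]: "G l \<in> borel_measurable borel" for l
    by (rule borel_measurable_continuous_onI[OF lipschitz_on_continuous_on[OF lipG]])
  have int: "integrable std_gaussian (\<lambda>z. (axis l 1 \<bullet> z) * G l z)" for l
  proof -
    define c where "c = \<bar>G l 0\<bar> + L * norm S * norm (A *v axis l 1)"
    have c: "0 \<le> c" using L by (simp add: c_def)
    have "\<bar>(axis l 1 \<bullet> z) * G l z\<bar> \<le> c * exp (2 * norm z)" for z
    proof -
      have "\<bar>G l z\<bar> \<le> \<bar>G l 0\<bar> * 1 + L * norm S * norm (A *v axis l 1) * norm z"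
        using lipschitz_onD[OF lipG, of z 0 l] by (simp add: dist_norm)
      also have "\<dots> \<le> \<bar>G l 0\<bar> * exp (norm z) + L * norm S * norm (A *v axis l 1) * exp (norm z)"
        using L le_exp_self by (intro add_mono mult_left_mono) auto
      finally have "\<bar>G l z\<bar> \<le> c * exp (norm z)" by (simp add: c_def algebra_simps)
      moreover have "\<bar>axis l 1 \<bullet> z\<bar> \<le> exp (norm z)"
        using component_le_norm_cart[of z l] le_exp_self[of "norm z"] by (simp add: inner_axis')
      ultimately have "\<bar>axis l 1 \<bullet> z\<bar> * \<bar>G l z\<bar> \<le> exp (norm z) * (c * exp (norm z))"
        by (intro mult_mono) auto
      moreover have "exp (2 * norm z) = exp (norm z) * exp (norm z)"
        by (simp add: exp_add[symmetric])
      ultimately show ?thesis by (simp add: abs_mult mult_ac)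
    qed
    then show ?thesis by (rule integrable_std_gaussian_of_bound[rotated]) measurable
  qed
  have expand: "g (a + S *v z) \<bullet> (A *v z) = (\<Sum>l\<in>UNIV. (axis l 1 \<bullet> z) * G l z)" for z
  proof -
    have "A *v z = A *v (\<Sum>l\<in>UNIV. (z $ l) *\<^sub>R axis l 1)"
      using basis_expansion[of z] by (simp add: scalar_mult_eq_scaleR)
    also have "\<dots> = (\<Sum>l\<in>UNIV. (z $ l) *\<^sub>R (A *v axis l 1))"
      by (simp add: linear_sum[OF matrix_vector_mul_linear] matrix_vector_mult_scaleR)
    finally show ?thesis
      by (simp add: inner_sum_right G_def inner_axis')
  qed
  have "(\<integral>z. g (a + S *v z) \<bullet> (A *v z) \<partial>std_gaussian) = (\<Sum>l\<in>UNIV. \<integral>z. (axis l 1 \<bullet> z) * G l z \<partial>std_gaussian)"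
    unfolding expand by (rule Bochner_Integration.integral_sum) (rule int)
  also have "\<dots> = (\<Sum>l\<in>UNIV. \<integral>z. G' l z (axis l 1) \<partial>std_gaussian)"
    by (intro sum.cong refl std_gaussian_integration_by_parts[OF lipG dG])
  also have "\<dots> = (\<integral>z. (\<Sum>l\<in>UNIV. G' l z (axis l 1)) \<partial>std_gaussian)"
    by (rule Bochner_Integration.integral_sum[symmetric]) (rule integrable_std_gaussian_derivative[OF lipG dG])
  finally have eq: "(\<integral>z. g (a + S *v z) \<bullet> (A *v z) \<partial>std_gaussian) =
    (\<integral>z. (\<Sum>l\<in>UNIV. G' l z (axis l 1)) \<partial>std_gaussian)" .
  let ?B = "L * (\<Sum>k\<in>UNIV. \<Sum>m\<in>UNIV. \<bar>(A ** transpose S) $ k $ m\<bar>)"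
  have "\<bar>\<Sum>l\<in>UNIV. G' l z (axis l 1)\<bar> \<le> ?B" for z
  proof -
    let ?p = "a + S *v z"
    have S: "g' ?p (S *v axis l 1) = (\<Sum>m\<in>UNIV. (S $ m $ l) *\<^sub>R g' ?p (axis m 1))" for l
    proof -
      have "S *v axis l 1 = (\<Sum>m\<in>UNIV. (S $ m $ l) *\<^sub>R axis m 1)"
        using basis_expansion[of "S *v axis l 1"]
        by (simp add: scalar_mult_eq_scaleR matrix_vector_mult_basis column_def)
      then show ?thesis by (simp add: linear_sum[OF lin] linear_cmul[OF lin])
    qed
    \<comment> \<open>Exchanging the sums turns this divergence into the sum over k, m of the (k, m)
      entry of A S^T times the m-th partial derivative of the k-th component of g. Each such partial
      derivative is at most L.\<close>
    have "(\<Sum>l\<in>UNIV. G' l z (axis l 1)) =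
        (\<Sum>l\<in>UNIV. \<Sum>k\<in>UNIV. \<Sum>m\<in>UNIV. S $ m $ l * g' ?p (axis m 1) $ k * A $ k $ l)"
      unfolding G'_def S inner_vec_def by (simp add: matrix_vector_mult_basis column_def sum_distrib_right)
    also have "\<dots> = (\<Sum>k\<in>UNIV. \<Sum>l\<in>UNIV. \<Sum>m\<in>UNIV. S $ m $ l * g' ?p (axis m 1) $ k * A $ k $ l)"
      by (rule sum.swap)
    also have "\<dots> = (\<Sum>k\<in>UNIV. \<Sum>m\<in>UNIV. \<Sum>l\<in>UNIV. S $ m $ l * g' ?p (axis m 1) $ k * A $ k $ l)"
      by (intro sum.cong refl sum.swap)
    also have "\<dots> = (\<Sum>k\<in>UNIV. \<Sum>m\<in>UNIV. (A ** transpose S) $ k $ m * (g' ?p (axis m 1) $ k))"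
      by (simp add: matrix_matrix_mult_def transpose_def sum_distrib_left sum_distrib_right mult_ac)
    finally have "\<bar>\<Sum>l\<in>UNIV. G' l z (axis l 1)\<bar> \<le>
        (\<Sum>k\<in>UNIV. \<Sum>m\<in>UNIV. \<bar>(A ** transpose S) $ k $ m * (g' ?p (axis m 1) $ k)\<bar>)"
      by (auto intro!: order_trans[OF sum_abs] sum_mono)
    also have "\<dots> \<le> (\<Sum>k\<in>UNIV. \<Sum>m\<in>UNIV. \<bar>(A ** transpose S) $ k $ m\<bar> * L)"
    proof (intro sum_mono)
      fix k m
      have "\<bar>g' ?p (axis m 1) $ k\<bar> \<le> L"
        using component_le_norm_cart[of "g' ?p (axis m 1)" k] g'_le[of ?p "axis m 1"] by (simp add: norm_axis_1)
      then show "\<bar>(A ** transpose S) $ k $ m * (g' ?p (axis m 1) $ k)\<bar> \<le> \<bar>(A ** transpose S) $ k $ m\<bar> * L"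
        unfolding abs_mult by (intro mult_left_mono) auto
    qed
    also have "\<dots> = ?B"
      by (simp add: sum_distrib_left mult.commute)
    finally show ?thesis .
  qed
  then have "\<bar>\<integral>z. (\<Sum>l\<in>UNIV. G' l z (axis l 1)) \<partial>std_gaussian\<bar> \<le> (\<integral>z. ?B \<partial>(std_gaussian :: (real^'q) measure))"
    by (intro abs_integral_le Bochner_Integration.integrable_sum integrable_std_gaussian_derivative[OF lipG dG]) auto
  then show ?thesis unfolding eq by (simp add: std_gaussian.prob_space)
qed

text \<open>E|Z|^2, that is, the dimension of the Gaussian; its value is never computed.\<close>

definition gauss_var :: "'q::finite itself \<Rightarrow> real"
  where "gauss_var _ = (\<integral>z. (norm z)\<^sup>2 \<partial>(std_gaussian :: (real^'q) measure))"

lemma gauss_var_nonneg: "0 \<le> gauss_var TYPE('q::finite)"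
  by (simp add: gauss_var_def)

lemma (in pair_sigma_finite) integrable_comp_fst:
  fixes f :: "_ \<Rightarrow> real"
  assumes "finite_measure M2" and f[measurable]: "integrable M1 f"
  shows "integrable (M1 \<Otimes>\<^sub>M M2) (\<lambda>w. f (fst w))"
proof (rule Fubini_integrable)
  interpret finite_measure M2 by fact
  show "integrable M1 (\<lambda>x. \<integral>y. norm (f (fst (x, y))) \<partial>M2)"
    using f by simp
  show "AE x in M1. integrable M2 (\<lambda>y. f (fst (x, y)))"
    by simp
qed measurable

lemma (in pair_sigma_finite) integrable_comp_snd:
  fixes f :: "_ \<Rightarrow> real"
  assumes "finite_measure M1" and f[measurable]: "integrable M2 f"
  shows "integrable (M1 \<Otimes>\<^sub>M M2) (\<lambda>w. f (snd w))"
proof (rule Fubini_integrable)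
  interpret finite_measure M1 by fact
  show "integrable M1 (\<lambda>x. \<integral>y. norm (f (snd (x, y))) \<partial>M2)"
    by simp
  show "AE x in M1. integrable M2 (\<lambda>y. f (snd (x, y)))"
    using f by simp
qed measurable

section \<open>The compensated jump and the joint noise\<close>

locale jump_law = mu: prob_space \<mu> for p :: real and \<mu> :: "real measure" +
  assumes p: "0 \<le> p" "p \<le> 1"
    and sets_mu [measurable_cong, simp]: "sets \<mu> = sets borel"
    and square_mu: "integrable \<mu> (\<lambda>u. u\<^sup>2)"
begin

definition jump :: "bool \<times> real \<Rightarrow> real"
  where "jump = (\<lambda>(j, u). of_bool j * u - p * (\<integral>v. v \<partial>\<mu>))"

abbreviation jumps :: "(bool \<times> real) measure"
  where "jumps \<equiv> measure_pmf (bernoulli_pmf p) \<Otimes>\<^sub>M \<mu>"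

lemma space_mu [simp]: "space \<mu> = UNIV"
  using sets_eq_imp_space_eq[OF sets_mu] by simp

lemma prob_mu [simp]: "mu.prob UNIV = 1"
  using mu.prob_space by simp

lemma integrable_mu: "integrable \<mu> (\<lambda>u. u)"
  by (rule mu.square_integrable_imp_integrable) (use square_mu in auto)

sublocale bernoulli_mu: pair_prob_space "measure_pmf (bernoulli_pmf p)" \<mu> ..

sublocale gauss_jumps: pair_prob_space "std_gaussian :: (real^'q::finite) measure" jumps ..

lemma measurable_jump [measurable]: "jump \<in> borel_measurable jumps"
  unfolding jump_def by measurable

lemma integrable_jump_square: "integrable jumps (\<lambda>q. (jump q)\<^sup>2)"
proof (rule Bochner_Integration.integrable_bound)
  let ?m = "p * (\<integral>v. v \<partial>\<mu>)"
  show "integrable jumps (\<lambda>q. 2 * (snd q)\<^sup>2 + 2 * ?m\<^sup>2)"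
    using bernoulli_mu.integrable_comp_snd[OF _ square_mu]
    by (auto simp: measure_pmf.finite_measure_axioms)
  have "(jump q)\<^sup>2 \<le> 2 * (snd q)\<^sup>2 + 2 * ?m\<^sup>2" for q
  proof -
    have "(a - b)\<^sup>2 \<le> 2 * a\<^sup>2 + 2 * b\<^sup>2" for a b :: real
      using zero_le_power2[of "a + b"] by (simp add: power2_eq_square algebra_simps)
    from this[of "of_bool (fst q) * snd q" ?m]
    have "(jump q)\<^sup>2 \<le> 2 * (of_bool (fst q) * snd q)\<^sup>2 + 2 * ?m\<^sup>2"
      by (simp add: jump_def split_beta)
    also have "\<dots> \<le> 2 * (snd q)\<^sup>2 + 2 * ?m\<^sup>2"
      by (auto simp: power_mult_distrib)
    finally show ?thesis .
  qed
  then show "AE q in jumps. norm ((jump q)\<^sup>2) \<le> norm (2 * (snd q)\<^sup>2 + 2 * ?m\<^sup>2)"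
    by (auto intro!: AE_I2 intro: order_trans[OF _ abs_ge_self])
qed measurable

lemma integrable_jump: "integrable jumps jump"
  by (rule bernoulli_mu.P.square_integrable_imp_integrable) (use integrable_jump_square in auto)

lemma integral_jump: "(\<integral>q. jump q \<partial>jumps) = 0"
proof -
  let ?m = "\<integral>v. v \<partial>\<mu>"
  have "(\<integral>q. jump q \<partial>jumps) = (\<integral>j. (\<integral>u. jump (j, u) \<partial>\<mu>) \<partial>measure_pmf (bernoulli_pmf p))"
    by (rule bernoulli_mu.integral_fst'[symmetric, OF integrable_jump])
  also have "(\<lambda>j. \<integral>u. jump (j, u) \<partial>\<mu>) = (\<lambda>j. of_bool j * ?m - p * ?m)"
    using integrable_mu by (auto simp: jump_def fun_eq_iff mu.prob_space)
  also have "(\<integral>j. (of_bool j * ?m - p * ?m) \<partial>measure_pmf (bernoulli_pmf p)) = 0"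
    using p by (simp add: algebra_simps)
  finally show ?thesis .
qed

text \<open>The exact value is p E U^2 - (p E U)^2. The factor p, later lam * h, is what gives jump
  terms the order h even though the jump itself has no small factor.\<close>

lemma integral_jump_square_le: "(\<integral>q. (jump q)\<^sup>2 \<partial>jumps) \<le> p * (\<integral>u. u\<^sup>2 \<partial>\<mu>)"
proof -
  let ?m = "\<integral>v. v \<partial>\<mu>" and ?s = "\<integral>u. u\<^sup>2 \<partial>\<mu>"
  have "(\<integral>q. (jump q)\<^sup>2 \<partial>jumps) = (\<integral>j. (\<integral>u. (jump (j, u))\<^sup>2 \<partial>\<mu>) \<partial>measure_pmf (bernoulli_pmf p))"
    by (rule bernoulli_mu.integral_fst'[symmetric, OF integrable_jump_square])
  also have "(\<lambda>j. \<integral>u. (jump (j, u))\<^sup>2 \<partial>\<mu>) = (\<lambda>j. of_bool j * (?s - 2 * p * ?m\<^sup>2) + (p * ?m)\<^sup>2)"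
  proof
    fix j
    have "(jump (j, u))\<^sup>2 = of_bool j * (u\<^sup>2 - 2 * (p * ?m) * u) + (p * ?m)\<^sup>2" for u
      by (auto simp: jump_def power2_eq_square algebra_simps)
    then show "(\<integral>u. (jump (j, u))\<^sup>2 \<partial>\<mu>) = of_bool j * (?s - 2 * p * ?m\<^sup>2) + (p * ?m)\<^sup>2"
      using integrable_mu square_mu by (simp add: mu.prob_space power2_eq_square)
  qed
  also have "(\<integral>j. (of_bool j * (?s - 2 * p * ?m\<^sup>2) + (p * ?m)\<^sup>2) \<partial>measure_pmf (bernoulli_pmf p)) = p * ?s - (p * ?m)\<^sup>2"
    using p by (simp add: algebra_simps power2_eq_square)
  finally show ?thesis by simp
qed

abbreviation noise_law :: "((real^'q::finite) \<times> bool \<times> real) measure"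
  where "noise_law \<equiv> std_gaussian \<Otimes>\<^sub>M jumps"

lemma noise_eq: "noise p \<mu> = noise_law"
  by (simp add: noise_def)

text \<open>One square-integrable function dominates everything: an affine expression in the noise
  is at most a constant times \<open>weight\<close>, and a product of two such expressions at most a
  constant times its square.\<close>

definition weight :: "(real^'q::finite) \<times> bool \<times> real \<Rightarrow> real"
  where "weight w = 1 + norm (fst w) + \<bar>jump (snd w)\<bar>"

lemma weight_ge_1: "1 \<le> weight w"
  by (simp add: weight_def)

lemma measurable_weight [measurable]: "weight \<in> borel_measurable noise_law"
  unfolding weight_def by measurable

lemma integrable_norm_fst_square:
  "integrable (noise_law :: ((real^'q::finite) \<times> bool \<times> real) measure) (\<lambda>w. (norm (fst w))\<^sup>2)"
  using gauss_jumps.integrable_comp_fst[OF _ integrable_std_gaussian_norm_square]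
  by (auto simp: bernoulli_mu.P.finite_measure_axioms)

lemma integrable_jump_snd_square:
  "integrable (noise_law :: ((real^'q::finite) \<times> bool \<times> real) measure) (\<lambda>w. (jump (snd w))\<^sup>2)"
  using gauss_jumps.integrable_comp_snd[OF _ integrable_jump_square]
  by (auto simp: std_gaussian.finite_measure_axioms)

lemma integrable_weight_square:
  "integrable (noise_law :: ((real^'q::finite) \<times> bool \<times> real) measure) (\<lambda>w. (weight w)\<^sup>2)"
proof (rule Bochner_Integration.integrable_bound)
  show "integrable (noise_law :: ((real^'q) \<times> bool \<times> real) measure)
      (\<lambda>w. 3 + 3 * (norm (fst w))\<^sup>2 + 3 * (jump (snd w))\<^sup>2)"
    using integrable_norm_fst_square integrable_jump_snd_square
    by (intro Bochner_Integration.integrable_add) auto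
  have "(1 + a + b)\<^sup>2 \<le> 3 + 3 * a\<^sup>2 + 3 * b\<^sup>2" for a b :: real
    using zero_le_power2[of "1 - a"] zero_le_power2[of "1 - b"] zero_le_power2[of "a - b"]
    by (simp add: power2_eq_square algebra_simps)
  from this[of "norm (fst w)" "\<bar>jump (snd w)\<bar>" for w]
  show "AE w in (noise_law :: ((real^'q) \<times> bool \<times> real) measure).
      norm ((weight w)\<^sup>2) \<le> norm (3 + 3 * (norm (fst w))\<^sup>2 + 3 * (jump (snd w))\<^sup>2)"
    unfolding weight_def by (intro AE_I2) (auto intro: order_trans[OF _ abs_ge_self])
qed measurable

lemma integrable_weight_bound:
  fixes f :: "(real^'q::finite) \<times> bool \<times> real \<Rightarrow> real"
  assumes [measurable]: "f \<in> borel_measurable noise_law" and "\<And>w. \<bar>f w\<bar> \<le> C * (weight w)\<^sup>2"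
  shows "integrable noise_law f"
proof (rule Bochner_Integration.integrable_bound)
  show "integrable (noise_law :: ((real^'q) \<times> bool \<times> real) measure) (\<lambda>w. C * (weight w)\<^sup>2)"
    by (intro integrable_mult_right integrable_weight_square)
  show "AE w in noise_law. norm (f w) \<le> norm (C * (weight w)\<^sup>2)"
    using assms(2) by (auto intro!: AE_I2 intro: order_trans[OF _ abs_ge_self])
qed measurable

lemma norm_affine_noise_le:
  fixes S :: "real^'q::finite^'d::finite"
  shows "norm (a + S *v fst w + jump (snd w) *\<^sub>R c) \<le> (norm a + norm S + norm c) * weight w"
proof -
  have "norm (a + S *v fst w + jump (snd w) *\<^sub>R c) \<le> norm a + norm (S *v fst w) + norm (jump (snd w) *\<^sub>R c)"
    by (intro order_trans[OF norm_triangle_ineq] add_mono norm_triangle_ineq) auto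
  also have "\<dots> \<le> norm a * weight w + norm S * weight w + norm c * weight w"
  proof (intro add_mono)
    show "norm a \<le> norm a * weight w"
      using mult_left_mono[OF weight_ge_1[of w], of "norm a"] by simp
    have "norm (S *v fst w) \<le> norm S * norm (fst w)" by (rule norm_matrix_vector_mult_le)
    also have "\<dots> \<le> norm S * weight w"
      by (intro mult_left_mono) (auto simp: weight_def)
    finally show "norm (S *v fst w) \<le> norm S * weight w" .
    have "\<bar>jump (snd w)\<bar> * norm c \<le> weight w * norm c"
      by (intro mult_right_mono) (auto simp: weight_def)
    then show "norm (jump (snd w) *\<^sub>R c) \<le> norm c * weight w" by (simp add: mult.commute)
  qed
  finally show ?thesis by (simp add: algebra_simps)
qed

lemma measurable_affine_noise [measurable]:
  fixes S :: "real^'q::finite^'d::finite"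
  shows "(\<lambda>w. a + S *v fst w + jump (snd w) *\<^sub>R c) \<in> borel_measurable noise_law"
proof -
  have [measurable]: "(\<lambda>z. S *v z) \<in> borel_measurable borel"
    by (intro borel_measurable_continuous_onI matrix_vector_mult_linear_continuous_on)
  show ?thesis by measurable
qed

text \<open>The Gaussian is integrated first, with the jump absorbed into the deterministic vector
  e. The mixed term is then a linear form in z with coefficient S^T e and has mean 0; the cross term
  between a and c vanishes because the jump is centred. So |a|^2 enters with coefficient 1 and no
  term of order sqrt h appears.\<close>

lemma
  fixes S :: "real^'q::finite^'d::finite"
  shows integrable_affine_noise_square:
      "integrable noise_law (\<lambda>w. (norm (a + S *v fst w + jump (snd w) *\<^sub>R c))\<^sup>2)"
    and integral_affine_noise_square_le:
      "(\<integral>w. (norm (a + S *v fst w + jump (snd w) *\<^sub>R c))\<^sup>2 \<partial>noise_law) \<le>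
        (norm a)\<^sup>2 + (norm S)\<^sup>2 * gauss_var TYPE('q) + p * (\<integral>u. u\<^sup>2 \<partial>\<mu>) * (norm c)\<^sup>2"
proof -
  show int: "integrable noise_law (\<lambda>w. (norm (a + S *v fst w + jump (snd w) *\<^sub>R c))\<^sup>2)"
  proof (rule integrable_weight_bound)
    fix w
    have "(norm (a + S *v fst w + jump (snd w) *\<^sub>R c))\<^sup>2 \<le> ((norm a + norm S + norm c) * weight w)\<^sup>2"
      by (intro power_mono norm_affine_noise_le) auto
    then show "\<bar>(norm (a + S *v fst w + jump (snd w) *\<^sub>R c))\<^sup>2\<bar> \<le> (norm a + norm S + norm c)\<^sup>2 * (weight w)\<^sup>2"
      by (simp add: power_mult_distrib)
  qed measurable
  have inner_le: "(\<integral>z. (norm (e + S *v z))\<^sup>2 \<partial>std_gaussian) \<le> (norm e)\<^sup>2 + (norm S)\<^sup>2 * gauss_var TYPE('q)" for e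
  proof -
    have [measurable]: "(\<lambda>z. S *v z) \<in> borel_measurable borel"
      by (intro borel_measurable_continuous_onI matrix_vector_mult_linear_continuous_on)
    have bd: "(norm (S *v z))\<^sup>2 \<le> (norm S)\<^sup>2 * (norm z)\<^sup>2" for z
      using power_mono[OF norm_matrix_vector_mult_le[of S z], of 2] by (simp add: power_mult_distrib)
    have i2: "integrable std_gaussian (\<lambda>z. (norm (S *v z))\<^sup>2)"
      by (rule Bochner_Integration.integrable_bound[of _ "\<lambda>z. (norm S)\<^sup>2 * (norm z)\<^sup>2"])
        (use bd integrable_std_gaussian_norm_square in auto)
    have eq: "(norm (e + S *v z))\<^sup>2 = (norm e)\<^sup>2 + 2 * ((transpose S *v e) \<bullet> z) + (norm (S *v z))\<^sup>2" for z
    proof -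
      have "(transpose S *v e) \<bullet> z = e \<bullet> (S *v z)"
        by (simp add: transpose_matrix_vector dot_lmul_matrix)
      then show ?thesis
        by (simp add: power2_norm_eq_inner inner_add inner_commute)
    qed
    have "(\<integral>z. (norm (e + S *v z))\<^sup>2 \<partial>std_gaussian) = (norm e)\<^sup>2 + (\<integral>z. (norm (S *v z))\<^sup>2 \<partial>std_gaussian)"
      unfolding eq using std_gaussian_linear_form[of "transpose S *v e"] i2 by (simp add: std_gaussian.prob_space)
    also have "(\<integral>z. (norm (S *v z))\<^sup>2 \<partial>std_gaussian) \<le> (\<integral>z. (norm S)\<^sup>2 * (norm z)\<^sup>2 \<partial>(std_gaussian :: (real^'q) measure))"
      by (rule integral_mono) (use bd i2 integrable_std_gaussian_norm_square in auto)
    finally show ?thesis by (simp add: gauss_var_def)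
  qed
  let ?K = "(norm S)\<^sup>2 * gauss_var TYPE('q)"
  have eq: "(norm (a + jump q *\<^sub>R c))\<^sup>2 = (norm a)\<^sup>2 + 2 * (a \<bullet> c) * jump q + (norm c)\<^sup>2 * (jump q)\<^sup>2" for q
    unfolding power2_norm_eq_inner by (simp add: inner_add inner_commute power2_eq_square algebra_simps)
  have int_q: "integrable jumps (\<lambda>q. (norm (a + jump q *\<^sub>R c))\<^sup>2)"
    unfolding eq using integrable_jump integrable_jump_square by simp
  have "(\<integral>w. (norm (a + S *v fst w + jump (snd w) *\<^sub>R c))\<^sup>2 \<partial>noise_law) =
      (\<integral>q. (\<integral>z. (norm (a + S *v z + jump q *\<^sub>R c))\<^sup>2 \<partial>std_gaussian) \<partial>jumps)"
    using gauss_jumps.integral_snd[of "\<lambda>z q. (norm (a + S *v z + jump q *\<^sub>R c))\<^sup>2"] int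
    by (simp add: split_beta')
  also have "\<dots> \<le> (\<integral>q. (norm (a + jump q *\<^sub>R c))\<^sup>2 + ?K \<partial>jumps)"
  proof (rule integral_mono)
    show "integrable jumps (\<lambda>q. \<integral>z. (norm (a + S *v z + jump q *\<^sub>R c))\<^sup>2 \<partial>std_gaussian)"
      using gauss_jumps.integrable_snd[of "\<lambda>z q. (norm (a + S *v z + jump q *\<^sub>R c))\<^sup>2"] int
      by (simp add: split_beta')
    show "(\<integral>z. (norm (a + S *v z + jump q *\<^sub>R c))\<^sup>2 \<partial>std_gaussian) \<le> (norm (a + jump q *\<^sub>R c))\<^sup>2 + ?K" for q
      using inner_le[of "a + jump q *\<^sub>R c"] by (simp add: algebra_simps)
  qed (use int_q in simp)
  also have "\<dots> = (norm a)\<^sup>2 + (norm c)\<^sup>2 * (\<integral>q. (jump q)\<^sup>2 \<partial>jumps) + ?K"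
    unfolding eq using integrable_jump integrable_jump_square
    by (simp add: bernoulli_mu.P.prob_space integral_jump)
  also have "\<dots> \<le> (norm a)\<^sup>2 + (norm c)\<^sup>2 * (p * (\<integral>u. u\<^sup>2 \<partial>\<mu>)) + ?K"
    by (intro add_mono mult_left_mono integral_jump_square_le) auto
  finally show "(\<integral>w. (norm (a + S *v fst w + jump (snd w) *\<^sub>R c))\<^sup>2 \<partial>noise_law) \<le>
      (norm a)\<^sup>2 + (norm S)\<^sup>2 * gauss_var TYPE('q) + p * (\<integral>u. u\<^sup>2 \<partial>\<mu>) * (norm c)\<^sup>2"
    by (simp add: mult_ac)
qed

lemma noise_Lipschitz_growth:
  fixes g :: "real^'d::finite \<Rightarrow> real^'d" and S :: "real^'q::finite^'d"
  assumes lip: "L-lipschitz_on UNIV g"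
  shows "norm (g (a + S *v fst w + jump (snd w) *\<^sub>R c)) \<le>
    (norm (g 0) + L * (norm a + norm S + norm c)) * weight w"
proof -
  let ?X = "a + S *v fst w + jump (snd w) *\<^sub>R c"
  have L: "0 \<le> L" using lip lipschitz_on_nonneg by blast
  have "norm (g ?X) \<le> norm (g 0) + norm (g ?X - g 0)"
    by (metis add.commute diff_add_cancel norm_triangle_ineq)
  also have "norm (g ?X - g 0) \<le> L * norm ?X"
    using lipschitz_onD[OF lip, of ?X 0] by (simp add: dist_norm)
  also have "\<dots> \<le> L * ((norm a + norm S + norm c) * weight w)"
    using L by (intro mult_left_mono norm_affine_noise_le)
  also have "norm (g 0) \<le> norm (g 0) * weight w"
    using mult_left_mono[OF weight_ge_1[of w], of "norm (g 0)"] by simp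
  finally show ?thesis by (simp add: algebra_simps)
qed

text \<open>Setting some of \<open>a'\<close>, \<open>A\<close>, \<open>c'\<close> to zero singles
  out the drift, Gaussian and jump parts, so this one statement serves all the splittings of
  expectations below.\<close>

lemma
  fixes g :: "real^'d::finite \<Rightarrow> real^'d" and S A :: "real^'q::finite^'d"
  assumes lip: "L-lipschitz_on UNIV g"
  shows integrable_noise_inner_affine: "integrable noise_law
    (\<lambda>w. g (a + S *v fst w + jump (snd w) *\<^sub>R c) \<bullet> (a' + A *v fst w + jump (snd w) *\<^sub>R c'))"
proof (rule integrable_weight_bound)
  fix w :: "(real^'q) \<times> bool \<times> real"
  let ?X = "a + S *v fst w + jump (snd w) *\<^sub>R c" and ?Y = "a' + A *v fst w + jump (snd w) *\<^sub>R c'"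
  have L: "0 \<le> L" using lip lipschitz_on_nonneg by blast
  have "\<bar>g ?X \<bullet> ?Y\<bar> \<le> norm (g ?X) * norm ?Y" by (rule Cauchy_Schwarz_ineq2)
  also have "\<dots> \<le> ((norm (g 0) + L * (norm a + norm S + norm c)) * weight w) *
      ((norm a' + norm A + norm c') * weight w)"
    using L weight_ge_1[of w] by (intro mult_mono noise_Lipschitz_growth[OF lip] norm_affine_noise_le) auto
  finally show "\<bar>g ?X \<bullet> ?Y\<bar> \<le> (norm (g 0) + L * (norm a + norm S + norm c)) *
      (norm a' + norm A + norm c') * (weight w)\<^sup>2"
    by (simp add: power2_eq_square mult_ac)
next
  have [measurable]: "g \<in> borel_measurable borel"
    by (rule borel_measurable_continuous_onI[OF lipschitz_on_continuous_on[OF lip]])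
  show "(\<lambda>w. g (a + S *v fst w + jump (snd w) *\<^sub>R c) \<bullet> (a' + A *v fst w + jump (snd w) *\<^sub>R c'))
      \<in> borel_measurable noise_law"
    by measurable
qed

text \<open>With the jump frozen it only moves the base point, on which the Gaussian estimate does
  not depend.\<close>

lemma noise_Stein_bound:
  fixes g :: "real^'d::finite \<Rightarrow> real^'d" and S A :: "real^'q::finite^'d"
  assumes lip: "L-lipschitz_on UNIV g" and diff: "\<And>x. g differentiable (at x)"
  shows "\<bar>\<integral>w. g (a + S *v fst w + jump (snd w) *\<^sub>R c) \<bullet> (A *v fst w) \<partial>noise_law\<bar> \<le>
    L * (\<Sum>k\<in>UNIV. \<Sum>m\<in>UNIV. \<bar>(A ** transpose S) $ k $ m\<bar>)"
proof -
  let ?B = "L * (\<Sum>k\<in>UNIV. \<Sum>m\<in>UNIV. \<bar>(A ** transpose S) $ k $ m\<bar>)"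
  let ?f = "\<lambda>z q. g (a + S *v z + jump q *\<^sub>R c) \<bullet> (A *v z)"
  have int: "integrable noise_law (\<lambda>(z, q). ?f z q)"
    using integrable_noise_inner_affine[OF lip, of a S c 0 A 0] by (simp add: split_beta')
  have "(\<integral>w. g (a + S *v fst w + jump (snd w) *\<^sub>R c) \<bullet> (A *v fst w) \<partial>noise_law) =
      (\<integral>q. (\<integral>z. ?f z q \<partial>std_gaussian) \<partial>jumps)"
    using gauss_jumps.integral_snd[OF int] by (simp add: split_beta')
  also have "\<bar>\<dots>\<bar> \<le> (\<integral>q. ?B \<partial>jumps)"
  proof (rule abs_integral_le)
    show "integrable jumps (\<lambda>q. \<integral>z. ?f z q \<partial>std_gaussian)"
      by (rule gauss_jumps.integrable_snd[OF int])
    show "\<bar>\<integral>z. ?f z q \<partial>std_gaussian\<bar> \<le> ?B" for q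
      using std_gaussian_Stein_bound[OF lip diff, of "a + jump q *\<^sub>R c" S A] by (simp add: ac_simps)
  qed simp
  finally show ?thesis by (simp add: bernoulli_mu.P.prob_space)
qed

text \<open>Since the compensated jump is centred, \<open>g\<close> may be replaced by its increment in the
  jump direction, which turns one factor of the jump into its square.\<close>

lemma noise_jump_bound:
  fixes g :: "real^'d::finite \<Rightarrow> real^'d" and S :: "real^'q::finite^'d"
  assumes lip: "L-lipschitz_on UNIV g"
  shows "\<bar>\<integral>w. g (a + S *v fst w + jump (snd w) *\<^sub>R c) \<bullet> (jump (snd w) *\<^sub>R e) \<partial>noise_law\<bar> \<le>
    L * (p * (\<integral>u. u\<^sup>2 \<partial>\<mu>)) * (norm c * norm e)"
proof -
  have L: "0 \<le> L" using lip lipschitz_on_nonneg by blast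
  let ?f = "\<lambda>z q. g (a + S *v z + jump q *\<^sub>R c) \<bullet> (jump q *\<^sub>R e)"
  let ?B = "L * norm c * norm e * (\<integral>q. (jump q)\<^sup>2 \<partial>jumps)"
  have [measurable]: "g \<in> borel_measurable borel"
    by (rule borel_measurable_continuous_onI[OF lipschitz_on_continuous_on[OF lip]])
  have int: "integrable noise_law (\<lambda>(z, q). ?f z q)"
    using integrable_noise_inner_affine[OF lip, of a S c 0 0 e] by (simp add: split_beta')
  have inner_le: "\<bar>\<integral>q. g (d + jump q *\<^sub>R c) \<bullet> (jump q *\<^sub>R e) \<partial>jumps\<bar> \<le> ?B" for d
  proof -
    let ?h = "\<lambda>q. (g (d + jump q *\<^sub>R c) - g d) \<bullet> (jump q *\<^sub>R e)"
    have bd: "\<bar>?h q\<bar> \<le> L * norm c * norm e * (jump q)\<^sup>2" for q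
    proof -
      have "\<bar>?h q\<bar> \<le> norm (g (d + jump q *\<^sub>R c) - g d) * norm (jump q *\<^sub>R e)"
        by (rule Cauchy_Schwarz_ineq2)
      also have "\<dots> \<le> (L * norm (jump q *\<^sub>R c)) * norm (jump q *\<^sub>R e)"
        using lipschitz_onD[OF lip, of "d + jump q *\<^sub>R c" d] by (intro mult_right_mono) (auto simp: dist_norm)
      also have "\<dots> = L * norm c * norm e * (jump q)\<^sup>2"
        by (simp add: power2_eq_square)
      finally show ?thesis .
    qed
    have int_h: "integrable jumps ?h"
      by (rule Bochner_Integration.integrable_bound[of _ "\<lambda>q. L * norm c * norm e * (jump q)\<^sup>2"])
        (use bd integrable_jump_square in \<open>auto intro!: AE_I2 intro: order_trans[OF _ abs_ge_self]\<close>)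
    have "(\<integral>q. g (d + jump q *\<^sub>R c) \<bullet> (jump q *\<^sub>R e) \<partial>jumps) = (\<integral>q. ?h q + (g d \<bullet> e) * jump q \<partial>jumps)"
      by (intro Bochner_Integration.integral_cong) (auto simp: inner_diff_left algebra_simps)
    also have "\<dots> = (\<integral>q. ?h q \<partial>jumps)"
      using int_h integrable_jump integral_jump by (subst Bochner_Integration.integral_add) auto
    also have "\<bar>\<dots>\<bar> \<le> (\<integral>q. L * norm c * norm e * (jump q)\<^sup>2 \<partial>jumps)"
      using int_h bd integrable_jump_square
      by (intro abs_integral_le) auto
    finally show ?thesis by simp
  qed
  \<comment> \<open>Here the Gaussian is frozen and the jump integrated first; d stands for the
    resulting base point.\<close>
  have "(\<integral>w. g (a + S *v fst w + jump (snd w) *\<^sub>R c) \<bullet> (jump (snd w) *\<^sub>R e) \<partial>noise_law) =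
      (\<integral>z. (\<integral>q. ?f z q \<partial>jumps) \<partial>std_gaussian)"
    using gauss_jumps.integral_fst[OF int] by (simp add: split_beta')
  also have "\<bar>\<dots>\<bar> \<le> (\<integral>z. ?B \<partial>(std_gaussian :: (real^'q) measure))"
  proof (rule abs_integral_le)
    show "integrable std_gaussian (\<lambda>z. \<integral>q. ?f z q \<partial>jumps)"
      by (rule gauss_jumps.integrable_fst[OF int])
    show "\<bar>\<integral>q. ?f z q \<partial>jumps\<bar> \<le> ?B" for z
      by (rule inner_le)
  qed simp
  also have "\<dots> = L * norm c * norm e * (\<integral>q. (jump q)\<^sup>2 \<partial>jumps)"
    by (simp add: std_gaussian.prob_space)
  also have "\<dots> \<le> L * norm c * norm e * (p * (\<integral>u. u\<^sup>2 \<partial>\<mu>))"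
    using L by (intro mult_left_mono integral_jump_square_le) auto
  finally show ?thesis by (simp add: mult_ac)
qed

end

section \<open>One step of the Euler scheme\<close>


lemma D2_expansion:
  fixes g :: "real^'d::finite \<Rightarrow> 'b::real_normed_vector"
  shows "blinfun_apply (blinfun_apply (D2 g x) u) v =
    (\<Sum>i\<in>UNIV. \<Sum>j\<in>UNIV. (u $ i * v $ j) *\<^sub>R partial2 i j g x)"
proof -
  have e: "w = (\<Sum>i\<in>UNIV. (w $ i) *\<^sub>R axis i 1)" for w :: "real^'d"
    using basis_expansion[of w] by (simp add: scalar_mult_eq_scaleR)
  have "blinfun_apply (blinfun_apply (D2 g x) u) v =
      blinfun_apply (blinfun_apply (D2 g x) (\<Sum>i\<in>UNIV. (u $ i) *\<^sub>R axis i 1)) (\<Sum>j\<in>UNIV. (v $ j) *\<^sub>R axis j 1)"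
    using e[of u] e[of v] by simp
  also have "\<dots> = (\<Sum>j\<in>UNIV. \<Sum>i\<in>UNIV. (u $ i * v $ j) *\<^sub>R partial2 i j g x)"
    by (simp add: blinfun.bilinear_simps scaleR_sum_right partial2_def mult.commute)
  also have "\<dots> = (\<Sum>i\<in>UNIV. \<Sum>j\<in>UNIV. (u $ i * v $ j) *\<^sub>R partial2 i j g x)"
    by (rule sum.swap)
  finally show ?thesis .
qed

lemma sum_sum_abs_le:
  fixes u v :: "real^'d::finite"
  assumes c: "\<And>i j. c i j \<le> K" and K: "0 \<le> K"
  shows "(\<Sum>i\<in>UNIV. \<Sum>j\<in>UNIV. \<bar>u $ i * v $ j\<bar> * c i j) \<le> (real CARD('d))\<^sup>2 * K * (norm u * norm v)"
proof -
  have "(\<Sum>i\<in>UNIV. \<Sum>j\<in>UNIV. \<bar>u $ i * v $ j\<bar> * c i j) \<le> (\<Sum>i\<in>(UNIV::'d set). \<Sum>j\<in>(UNIV::'d set). (norm u * norm v) * K)"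
  proof (intro sum_mono)
    fix i j
    have "\<bar>u $ i * v $ j\<bar> * c i j \<le> \<bar>u $ i * v $ j\<bar> * K"
      using c by (intro mult_left_mono) auto
    also have "\<dots> \<le> (norm u * norm v) * K"
      using K component_le_norm_cart by (intro mult_right_mono) (auto simp: abs_mult intro!: mult_mono)
    finally show "\<bar>u $ i * v $ j\<bar> * c i j \<le> (norm u * norm v) * K" .
  qed
  then show ?thesis by (simp add: power2_eq_square mult_ac)
qed

lemma op_norm_ge:
  fixes A :: "real^'m::finite^'k::finite"
  shows "norm (A *v x) \<le> op_norm A * norm x"
  unfolding op_norm_def by (rule onorm) (simp add: linear_conv_bounded_linear[symmetric])

lemma op_norm_nonneg: "0 \<le> op_norm (A :: real^'m::finite^'k::finite)"
  unfolding op_norm_def by (rule onorm_pos_le) (simp add: linear_conv_bounded_linear[symmetric])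

lemma entry_le_op_norm:
  fixes A :: "real^'m::finite^'k::finite"
  shows "\<bar>A $ k $ m\<bar> \<le> op_norm A"
proof -
  have "\<bar>A $ k $ m\<bar> = \<bar>(A *v axis m 1) $ k\<bar>"
    by (simp add: matrix_vector_mult_basis column_def)
  also have "\<dots> \<le> norm (A *v axis m 1)" by (rule component_le_norm_cart)
  also have "\<dots> \<le> op_norm A * norm (axis m (1::real))" by (rule op_norm_ge)
  finally show ?thesis by (simp add: norm_axis_1)
qed

text \<open>The rank-one matrix a c^T maps c to |c|^2 a.\<close>

lemma norm_mult_le_op_norm_outer:
  fixes a c :: "real^'d::finite"
  shows "norm a * norm c \<le> op_norm (col_matrix a ** transpose (col_matrix c))"
proof (cases "c = 0")
  case True then show ?thesis by (simp add: op_norm_nonneg)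
next
  case False
  have "(col_matrix a ** transpose (col_matrix c)) *v c = (norm c)\<^sup>2 *\<^sub>R a"
    by (simp add: vec_eq_iff matrix_vector_mult_def matrix_matrix_mult_def transpose_def col_matrix_def
        columnvector_def power2_norm_eq_inner inner_vec_def sum_distrib_left mult_ac)
  then have "(norm c)\<^sup>2 * norm a \<le> op_norm (col_matrix a ** transpose (col_matrix c)) * norm c"
    using op_norm_ge[of "col_matrix a ** transpose (col_matrix c)" c] by simp
  then have "(norm a * norm c) * norm c \<le> op_norm (col_matrix a ** transpose (col_matrix c)) * norm c"
    by (simp add: power2_eq_square mult_ac)
  with False show ?thesis by simp
qed

text \<open>Of the factor d^4, one d^2 comes from expanding the second derivative in coordinate
  partials and one from summing over the matrix entries.\<close>

lemma D2_mult_transpose_entries_le: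
  fixes \<sigma> :: "real^'d::finite \<Rightarrow> real^'q::finite^'d" and B :: "real^'q^'d"
  assumes "\<And>i j. op_norm (partial2 i j \<sigma> x ** transpose B) \<le> K"
  shows "(\<Sum>k\<in>UNIV. \<Sum>m\<in>UNIV. \<bar>(blinfun_apply (blinfun_apply (D2 \<sigma> x) u) v ** transpose B) $ k $ m\<bar>) \<le>
    real CARD('d) ^ 4 * K * (norm u * norm v)"
proof -
  have K: "0 \<le> K" using assms op_norm_nonneg order_trans by blast
  have "\<bar>(blinfun_apply (blinfun_apply (D2 \<sigma> x) u) v ** transpose B) $ k $ m\<bar> \<le>
      (real CARD('d))\<^sup>2 * K * (norm u * norm v)" for k m
  proof -
    have lin: "linear (\<lambda>A. (A ** transpose B) $ k $ m)"
      by (rule linearI) (simp_all add: matrix_matrix_mult_def sum.distrib sum_distrib_left algebra_simps)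
    have "(blinfun_apply (blinfun_apply (D2 \<sigma> x) u) v ** transpose B) $ k $ m =
        (\<Sum>i\<in>UNIV. \<Sum>j\<in>UNIV. (u $ i * v $ j) * (partial2 i j \<sigma> x ** transpose B) $ k $ m)"
      unfolding D2_expansion linear_sum[OF lin] linear_cmul[OF lin] by simp
    also have "\<bar>\<dots>\<bar> \<le> (\<Sum>i\<in>UNIV. \<Sum>j\<in>UNIV. \<bar>u $ i * v $ j\<bar> * \<bar>(partial2 i j \<sigma> x ** transpose B) $ k $ m\<bar>)"
      by (auto intro!: order_trans[OF sum_abs] sum_mono simp: abs_mult)
    also have "\<dots> \<le> (real CARD('d))\<^sup>2 * K * (norm u * norm v)"
      by (rule sum_sum_abs_le[OF order_trans[OF entry_le_op_norm assms] K])
    finally show ?thesis .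
  qed
  then have "(\<Sum>k\<in>UNIV. \<Sum>m\<in>UNIV. \<bar>(blinfun_apply (blinfun_apply (D2 \<sigma> x) u) v ** transpose B) $ k $ m\<bar>) \<le>
      (\<Sum>k\<in>(UNIV::'d set). \<Sum>m\<in>(UNIV::'d set). (real CARD('d))\<^sup>2 * K * (norm u * norm v))"
    by (intro sum_mono)
  then show ?thesis by (simp add: power2_eq_square eval_nat_numeral mult_ac)
qed

text \<open>Only the expansion in i and j costs a factor here, hence d^2: the operator norm of a
  rank-one matrix already controls the product of the two vector norms.\<close>

lemma norm_mult_D2_le:
  fixes \<gamma> :: "real^'d::finite \<Rightarrow> real^'d" and c :: "real^'d"
  assumes "\<And>i j. op_norm (col_matrix (partial2 i j \<gamma> x) ** transpose (col_matrix c)) \<le> K"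
  shows "norm c * norm (blinfun_apply (blinfun_apply (D2 \<gamma> x) u) v) \<le> (real CARD('d))\<^sup>2 * K * (norm u * norm v)"
proof -
  have K: "0 \<le> K" using assms op_norm_nonneg order_trans by blast
  have "norm (blinfun_apply (blinfun_apply (D2 \<gamma> x) u) v) \<le>
      (\<Sum>i\<in>UNIV. \<Sum>j\<in>UNIV. \<bar>u $ i * v $ j\<bar> * norm (partial2 i j \<gamma> x))"
    unfolding D2_expansion by (auto intro!: order_trans[OF norm_sum] sum_mono)
  then have "norm c * norm (blinfun_apply (blinfun_apply (D2 \<gamma> x) u) v) \<le>
      norm c * (\<Sum>i\<in>UNIV. \<Sum>j\<in>UNIV. \<bar>u $ i * v $ j\<bar> * norm (partial2 i j \<gamma> x))"
    by (intro mult_left_mono) auto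
  also have "\<dots> = (\<Sum>i\<in>UNIV. \<Sum>j\<in>UNIV. \<bar>u $ i * v $ j\<bar> * (norm (partial2 i j \<gamma> x) * norm c))"
    by (simp add: sum_distrib_left mult_ac)
  also have "\<dots> \<le> (real CARD('d))\<^sup>2 * K * (norm u * norm v)"
    by (rule sum_sum_abs_le[OF order_trans[OF norm_mult_le_op_norm_outer assms] K])
  finally show ?thesis .
qed

text \<open>A class that P maps into itself using only the first-order bounds on the coefficients.
  Its members grow at most quadratically, which is what a noise with finite second moment can
  integrate.\<close>

definition grad_linear_growth :: "(real^'d::finite \<Rightarrow> real) \<Rightarrow> bool"
  where "grad_linear_growth f \<longleftrightarrow> (\<forall>x. f differentiable (at x)) \<and>
    (\<exists>a\<ge>0. \<exists>c\<ge>0. \<forall>x. norm (grad f x) \<le> a + c * norm x)"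

lemma grad_linear_growth_of_Lipschitz:
  assumes "\<And>x. f differentiable (at x)" and lip: "L-lipschitz_on UNIV (grad f)"
  shows "grad_linear_growth f"
proof -
  have "norm (grad f x) \<le> norm (grad f 0) + L * norm x" for x
    using lipschitz_onD[OF lip, of x 0] norm_triangle_ineq2[of "grad f x" "grad f 0"]
    by (simp add: dist_norm)
  then show ?thesis
    unfolding grad_linear_growth_def using assms(1) lipschitz_on_nonneg[OF lip]
    by (meson norm_ge_zero)
qed

text \<open>Mean value inequality on the centred ball of radius |x| + |y|, a convex set containing
  both points.\<close>

lemma abs_diff_le_grad_growth:
  assumes "\<And>x. f differentiable (at x)" "\<And>x. norm (grad f x) \<le> a + c * norm x" "c \<ge> 0"
  shows "\<bar>f x - f y\<bar> \<le> (a + c * (norm x + norm y)) * norm (x - y)"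
proof -
  let ?R = "norm x + norm y"
  have "norm (f x - f y) \<le> (a + c * ?R) * norm (x - y)"
  proof (rule differentiable_bound[of "cball 0 ?R" f "\<lambda>x v. grad f x \<bullet> v"])
    show "(f has_derivative (\<lambda>v. grad f z \<bullet> v)) (at z within cball 0 ?R)" for z
      using has_derivative_grad[OF assms(1)] has_derivative_at_withinI by blast
    show "onorm (\<lambda>v. grad f z \<bullet> v) \<le> a + c * ?R" if "z \<in> cball 0 ?R" for z
    proof (rule onorm_le)
      fix v
      have "norm (grad f z \<bullet> v) \<le> norm (grad f z) * norm v"
        using Cauchy_Schwarz_ineq2 by simp
      also have "norm (grad f z) \<le> a + c * ?R"
        using assms(2)[of z] mult_left_mono[of "norm z" ?R c] that assms(3) by simp
      finally show "norm (grad f z \<bullet> v) \<le> (a + c * ?R) * norm v"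
        by (simp add: mult_right_mono)
    qed
  qed auto
  then show ?thesis by simp
qed

text \<open>Young's inequality with a free parameter. If a is the quotient of the expected sizes of
  s and t, the integrated bound is the one Cauchy-Schwarz would give.\<close>

lemma mult_le_weighted_squares:
  fixes s t a :: real
  assumes "0 < a"
  shows "s * t \<le> (s\<^sup>2 / a + a * t\<^sup>2) / 2"
proof -
  have "0 \<le> (s - a * t)\<^sup>2 / a" using assms by simp
  also have "\<dots> = s\<^sup>2 / a - 2 * (s * t) + a * t\<^sup>2"
    using assms by (simp add: power2_eq_square field_simps)
  finally show ?thesis by simp
qed

text \<open>The jump probability p and the step h are unrelated here. With p = lam * h, substituted
  in the final theorem, the terms in \<open>\<theta>\<close> become of order h.\<close>

locale euler_scheme = jump_law p \<mu> for p :: real and \<mu> :: "real measure" +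
  fixes h :: real
    and b :: "real^'d::finite \<Rightarrow> real^'d"
    and \<sigma> :: "real^'d \<Rightarrow> real^'q::finite^'d"
    and \<gamma> :: "real^'d \<Rightarrow> real^'d"
    and Kb Ks Kg Kss Kgg :: real
  assumes h: "0 < h"
    and b2: "twice_differentiable b" and s2: "twice_differentiable \<sigma>" and g2: "twice_differentiable \<gamma>"
    and Db: "\<And>x. norm (D1 b x) \<le> Kb" and Ds: "\<And>x. norm (D1 \<sigma> x) \<le> Ks" and Dg: "\<And>x. norm (D1 \<gamma> x) \<le> Kg"
    and Dss: "\<And>i j x. op_norm (partial2 i j \<sigma> x ** transpose (\<sigma> x)) \<le> Kss"
    and Dgg: "\<And>i j x. op_norm (col_matrix (partial2 i j \<gamma> x) ** transpose (col_matrix (\<gamma> x))) \<le> Kgg"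
begin

text \<open>\<open>X\<close>, \<open>XD\<close> and \<open>XDD\<close> share the form a + S z + jump
  c, with the factor sqrt h put inside S, so the moment, Stein and jump estimates for affine noise
  apply to them directly.\<close>

definition X :: "real^'d \<Rightarrow> (real^'q) \<times> bool \<times> real \<Rightarrow> real^'d"
  where "X x w = (x + h *\<^sub>R b x) + (sqrt h *\<^sub>R \<sigma> x) *v fst w + jump (snd w) *\<^sub>R \<gamma> x"

definition XD :: "real^'d \<Rightarrow> real^'d \<Rightarrow> (real^'q) \<times> bool \<times> real \<Rightarrow> real^'d"
  where "XD x v w = (v + h *\<^sub>R D1 b x v) + (sqrt h *\<^sub>R D1 \<sigma> x v) *v fst w + jump (snd w) *\<^sub>R D1 \<gamma> x v"

definition XDD :: "real^'d \<Rightarrow> real^'d \<Rightarrow> real^'d \<Rightarrow> (real^'q) \<times> bool \<times> real \<Rightarrow> real^'d"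
  where "XDD x u v w = h *\<^sub>R D2 b x u v + (sqrt h *\<^sub>R D2 \<sigma> x u v) *v fst w + jump (snd w) *\<^sub>R D2 \<gamma> x u v"

definition P :: "(real^'d \<Rightarrow> real) \<Rightarrow> real^'d \<Rightarrow> real"
  where "P f x = (\<integral>w. f (X x w) \<partial>noise_law)"

definition \<theta> :: real where "\<theta> = p * (\<integral>u. u\<^sup>2 \<partial>\<mu>)"

text \<open>Controls the mean squares of \<open>XD x v\<close> and of \<open>X y - X x\<close>
  relative to those of v and y - x. It is 1 + O(h) when p is of order h; being at least 1, it also
  dominates its own square root.\<close>

definition flow_bound :: real
  where "flow_bound = (1 + h * Kb)\<^sup>2 + h * Ks\<^sup>2 * gauss_var TYPE('q) + \<theta> * Kg\<^sup>2"

text \<open>In contrast with \<open>flow_bound\<close> this does not tend to 1 with h. It enters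
  only where finiteness matters: dominations, integrability and growth.\<close>

definition pathwise_bound :: real
  where "pathwise_bound = (1 + h * Kb) + sqrt h * Ks + Kg"

lemma K_nonneg: "0 \<le> Kb" "0 \<le> Ks" "0 \<le> Kg"
  using Db Ds Dg norm_ge_zero order_trans by blast+

lemma \<theta>_nonneg: "0 \<le> \<theta>"
  using p by (simp add: \<theta>_def)

lemma flow_bound_ge_1: "1 \<le> flow_bound"
proof -
  have "1 \<le> (1 + h * Kb)\<^sup>2"
    using h K_nonneg by (intro one_le_power) auto
  then show ?thesis
    unfolding flow_bound_def using h gauss_var_nonneg[where 'q='q] \<theta>_nonneg by (simp add: add_increasing2)
qed

lemma pathwise_bound_nonneg: "0 \<le> pathwise_bound"
  unfolding pathwise_bound_def using h K_nonneg by simp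

lemma measurable_X [measurable]: "X x \<in> borel_measurable noise_law"
  unfolding X_def by measurable

lemma X_has_derivative: "((\<lambda>y. X y w) has_derivative (\<lambda>v. XD x v w)) (at x)"
proof -
  have 1: "bounded_linear (\<lambda>A :: real^'q^'d. A *v fst w)"
    unfolding linear_conv_bounded_linear[symmetric]
    by (rule linearI) (simp_all add: matrix_vector_mult_add_rdistrib scaleR_matrix_vector_assoc)
  show ?thesis
    unfolding X_def XD_def
    by (intro has_derivative_add has_derivative_ident has_derivative_scaleR_right
        bounded_linear.has_derivative[OF 1] twice_differentiable_D1[OF b2] twice_differentiable_D1[OF s2]
        twice_differentiable_D1[OF g2])
qed

lemma XD_has_derivative: "((\<lambda>y. XD y v w) has_derivative (\<lambda>u. XDD x u v w)) (at x)"
proof -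
  have 1: "bounded_linear (\<lambda>A :: real^'q^'d. A *v fst w)"
    unfolding linear_conv_bounded_linear[symmetric]
    by (rule linearI) (simp_all add: matrix_vector_mult_add_rdistrib scaleR_matrix_vector_assoc)
  have 2: "((\<lambda>y. D1 g y v) has_derivative (\<lambda>u. D2 g x u v)) (at x)" if "twice_differentiable g"
    for g :: "real^'d \<Rightarrow> 'e::real_normed_vector"
    by (rule bounded_linear.has_derivative[OF blinfun.bounded_linear_left twice_differentiable_D2[OF that]])
  have "((\<lambda>y. XD y v w) has_derivative (\<lambda>u. (0 + h *\<^sub>R D2 b x u v) + (sqrt h *\<^sub>R D2 \<sigma> x u v) *v fst w
      + jump (snd w) *\<^sub>R D2 \<gamma> x u v)) (at x)"
    unfolding XD_def
    by (intro has_derivative_add has_derivative_const has_derivative_scaleR_right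
        bounded_linear.has_derivative[OF 1] 2 b2 s2 g2)
  then show ?thesis by (simp add: XDD_def)
qed

lemma norm_D1_apply_le: "norm (D1 g x) \<le> K \<Longrightarrow> norm (D1 g x v) \<le> K * norm v"
  by (rule order_trans[OF norm_blinfun mult_right_mono]) auto

lemma norm_drift_le:
  assumes "norm y \<le> Kb * norm v"
  shows "norm (v + h *\<^sub>R y) \<le> (1 + h * Kb) * norm v"
proof -
  have "norm (v + h *\<^sub>R y) \<le> norm v + h * norm y"
    using norm_triangle_ineq[of v "h *\<^sub>R y"] h by simp
  also have "\<dots> \<le> norm v + h * (Kb * norm v)"
    using assms h by simp
  finally show ?thesis by (simp add: algebra_simps)
qed

text \<open>The derivative \<open>XD x v\<close> and the increment \<open>X y - X x\<close> have
  coefficients obeying the same estimates, the former by the bounds on \<open>D1\<close>, the latter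
  by the mean value inequality. Both cases are settled here.\<close>

lemma affine_noise_bounds:
  fixes a c v :: "real^'d" and S :: "real^'q^'d"
  assumes "norm a \<le> (1 + h * Kb) * norm v" "norm S \<le> sqrt h * Ks * norm v" "norm c \<le> Kg * norm v"
  shows "(\<integral>w. (norm (a + S *v fst w + jump (snd w) *\<^sub>R c))\<^sup>2 \<partial>noise_law) \<le> flow_bound * (norm v)\<^sup>2"
    and "norm (a + S *v fst w + jump (snd w) *\<^sub>R c) \<le> pathwise_bound * norm v * weight w"
proof -
  have "(\<integral>w. (norm (a + S *v fst w + jump (snd w) *\<^sub>R c))\<^sup>2 \<partial>noise_law) \<le>
      (norm a)\<^sup>2 + (norm S)\<^sup>2 * gauss_var TYPE('q) + \<theta> * (norm c)\<^sup>2"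
    unfolding \<theta>_def by (rule integral_affine_noise_square_le)
  also have "\<dots> \<le> ((1 + h * Kb) * norm v)\<^sup>2 + (sqrt h * Ks * norm v)\<^sup>2 * gauss_var TYPE('q) + \<theta> * (Kg * norm v)\<^sup>2"
    using assms gauss_var_nonneg[where 'q='q] \<theta>_nonneg
    by (intro add_mono mult_left_mono mult_right_mono power_mono) auto
  also have "\<dots> = flow_bound * (norm v)\<^sup>2"
    unfolding flow_bound_def power_mult_distrib real_sqrt_pow2[OF less_imp_le[OF h]] by algebra
  finally show "(\<integral>w. (norm (a + S *v fst w + jump (snd w) *\<^sub>R c))\<^sup>2 \<partial>noise_law) \<le> flow_bound * (norm v)\<^sup>2" .
  have "norm (a + S *v fst w + jump (snd w) *\<^sub>R c) \<le> (norm a + norm S + norm c) * weight w"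
    by (rule norm_affine_noise_le)
  also have "norm a + norm S + norm c \<le> pathwise_bound * norm v"
    unfolding pathwise_bound_def using assms by (simp add: algebra_simps)
  finally show "norm (a + S *v fst w + jump (snd w) *\<^sub>R c) \<le> pathwise_bound * norm v * weight w"
    using weight_ge_1[of w] by (simp add: mult_right_mono)
qed

lemma
  shows XD_square_le: "(\<integral>w. (norm (XD x v w))\<^sup>2 \<partial>noise_law) \<le> flow_bound * (norm v)\<^sup>2"
    and norm_XD_le: "norm (XD x v w) \<le> pathwise_bound * norm v * weight w"
    and integrable_XD_square: "integrable noise_law (\<lambda>w. (norm (XD x v w))\<^sup>2)"
proof -
  have 1: "norm (v + h *\<^sub>R D1 b x v) \<le> (1 + h * Kb) * norm v"
    by (rule norm_drift_le[OF norm_D1_apply_le[OF Db]])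
  have 2: "norm (sqrt h *\<^sub>R D1 \<sigma> x v) \<le> sqrt h * Ks * norm v"
    using mult_left_mono[OF norm_D1_apply_le[OF Ds], of "sqrt h" x v] h by (simp add: mult_ac)
  note 3 = norm_D1_apply_le[OF Dg, of x v]
  show "(\<integral>w. (norm (XD x v w))\<^sup>2 \<partial>noise_law) \<le> flow_bound * (norm v)\<^sup>2"
    "norm (XD x v w) \<le> pathwise_bound * norm v * weight w"
    unfolding XD_def by (rule affine_noise_bounds[OF 1 2 3])+
  show "integrable noise_law (\<lambda>w. (norm (XD x v w))\<^sup>2)"
    unfolding XD_def by (rule integrable_affine_noise_square)
qed

lemma
  shows X_diff_square_le: "(\<integral>w. (norm (X y w - X x w))\<^sup>2 \<partial>noise_law) \<le> flow_bound * (norm (y - x))\<^sup>2"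
    and norm_X_diff_le: "norm (X y w - X x w) \<le> pathwise_bound * norm (y - x) * weight w"
    and integrable_X_diff_square: "integrable noise_law (\<lambda>w. (norm (X y w - X x w))\<^sup>2)"
proof -
  have eq: "X y w - X x w = ((y - x) + h *\<^sub>R (b y - b x)) + (sqrt h *\<^sub>R (\<sigma> y - \<sigma> x)) *v fst w
      + jump (snd w) *\<^sub>R (\<gamma> y - \<gamma> x)" for w
    by (simp add: X_def scaleR_diff_right matrix_vector_mult_diff_rdistrib algebra_simps)
  have 1: "norm ((y - x) + h *\<^sub>R (b y - b x)) \<le> (1 + h * Kb) * norm (y - x)"
    by (rule norm_drift_le[OF norm_diff_le_of_D1_bound[OF twice_differentiable_D1[OF b2] Db]])
  have 2: "norm (sqrt h *\<^sub>R (\<sigma> y - \<sigma> x)) \<le> sqrt h * Ks * norm (y - x)"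
    using mult_left_mono[OF norm_diff_le_of_D1_bound[OF twice_differentiable_D1[OF s2] Ds], of "sqrt h" y x] h
    by (simp add: mult_ac)
  note 3 = norm_diff_le_of_D1_bound[OF twice_differentiable_D1[OF g2] Dg, of y x]
  show "(\<integral>w. (norm (X y w - X x w))\<^sup>2 \<partial>noise_law) \<le> flow_bound * (norm (y - x))\<^sup>2"
    "norm (X y w - X x w) \<le> pathwise_bound * norm (y - x) * weight w"
    unfolding eq by (rule affine_noise_bounds[OF 1 2 3])+
  show "integrable noise_law (\<lambda>w. (norm (X y w - X x w))\<^sup>2)"
    unfolding eq by (rule integrable_affine_noise_square)
qed

text \<open>The size of a step from the origin, which is all that is lost when the Lipschitz bound
  in x is turned into a growth bound.\<close>

definition X_offset :: real
  where "X_offset = norm (h *\<^sub>R b 0) + norm (sqrt h *\<^sub>R \<sigma> 0) + norm (\<gamma> 0)"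

lemma norm_X_le: "norm (X x w) \<le> (X_offset + pathwise_bound * norm x) * weight w"
proof -
  have "norm (X x w) \<le> norm (X 0 w) + norm (X x w - X 0 w)"
    by (metis add.commute diff_add_cancel norm_triangle_ineq)
  also have "norm (X 0 w) \<le> X_offset * weight w"
    unfolding X_def X_offset_def using norm_affine_noise_le[of "h *\<^sub>R b 0" "sqrt h *\<^sub>R \<sigma> 0" w "\<gamma> 0"] by simp
  also have "norm (X x w - X 0 w) \<le> pathwise_bound * norm x * weight w"
    using norm_X_diff_le[of x w 0] by simp
  finally show ?thesis by (simp add: algebra_simps)
qed

lemma X_offset_nonneg: "0 \<le> X_offset"
  by (simp add: X_offset_def)

text \<open>Along a step f is of order \<open>weight\<close> squared, and so are its increments near
  x, relative to |y - x|. Since |grad f(X)| is at most \<open>weight\<close> times an affine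
  function of |x|, and |DX v| at most \<open>weight\<close> times |v|, the growth stays
  linear.\<close>

lemma
  assumes f: "grad_linear_growth f"
  shows integrable_X: "integrable noise_law (\<lambda>w. f (X x w))"
    and integrable_grad_XD: "integrable noise_law (\<lambda>w. grad f (X x w) \<bullet> XD x v w)"
    and P_has_derivative: "(P f has_derivative (\<lambda>v. \<integral>w. grad f (X x w) \<bullet> XD x v w \<partial>noise_law)) (at x)"
    and grad_linear_growth_P: "grad_linear_growth (P f)"
proof -
  from f obtain a c where diff: "\<And>x. f differentiable (at x)" and a: "0 \<le> a" and c: "0 \<le> c"
    and growth: "\<And>x. norm (grad f x) \<le> a + c * norm x"
    unfolding grad_linear_growth_def by blast
  note f_diff = abs_diff_le_grad_growth[OF diff growth c]
  have [measurable]: "f \<in> borel_measurable borel"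
    using diff by (intro borel_measurable_continuous_onI) (simp add: continuous_at_imp_continuous_on differentiable_imp_continuous_within)
  define B where "B = pathwise_bound"
  have B: "0 \<le> B" by (simp add: B_def pathwise_bound_nonneg)
  define A where "A r = X_offset + B * r" for r
  have A: "norm (X x w) \<le> A (norm x) * weight w" for x w
    unfolding A_def B_def by (rule norm_X_le)
  have A_nonneg: "0 \<le> A r" if "0 \<le> r" for r
    using that B X_offset_nonneg by (simp add: A_def)
  have wt: "0 \<le> weight w" "weight w \<le> (weight w)\<^sup>2" "1 \<le> (weight w)\<^sup>2" for w :: "(real^'q) \<times> bool \<times> real"
    using mult_left_mono[OF weight_ge_1[of w], of "weight w"] weight_ge_1[of w] one_le_power[OF weight_ge_1[of w], of 2]
    by (auto simp: power2_eq_square)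
  have a_wt: "a \<le> a * weight w" for w :: "(real^'q) \<times> bool \<times> real"
    using mult_left_mono[OF weight_ge_1[of w] a] by simp
  have int_f: "integrable noise_law (\<lambda>w. f (X x w))" for x
  proof (rule integrable_weight_bound)
    fix w
    let ?A = "A (norm x)"
    have "\<bar>f (X x w)\<bar> \<le> \<bar>f 0\<bar> + (a + c * norm (X x w)) * norm (X x w)"
      using f_diff[of "X x w" 0] by simp
    also have "\<dots> \<le> \<bar>f 0\<bar> + (a + c * (?A * weight w)) * (?A * weight w)"
      using A[of x w] a c A_nonneg[of "norm x"] wt
      by (intro add_mono mult_mono order_refl) auto
    also have "\<dots> = \<bar>f 0\<bar> * 1 + a * ?A * weight w + c * ?A\<^sup>2 * (weight w)\<^sup>2"
      by (simp add: algebra_simps power2_eq_square)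
    also have "\<dots> \<le> \<bar>f 0\<bar> * (weight w)\<^sup>2 + a * ?A * (weight w)\<^sup>2 + c * ?A\<^sup>2 * (weight w)\<^sup>2"
      using wt a A_nonneg[of "norm x"] by (intro add_mono mult_left_mono order_refl) auto
    finally show "\<bar>f (X x w)\<bar> \<le> (\<bar>f 0\<bar> + a * ?A + c * ?A\<^sup>2) * (weight w)\<^sup>2"
      by (simp add: algebra_simps)
  qed measurable
  then show "integrable noise_law (\<lambda>w. f (X x w))" .
  \<comment> \<open>For y in the unit ball around x both \<open>X x w\<close> and
    \<open>X y w\<close> are at most \<open>A (norm x + 1) * weight w\<close>, hence the 2; B comes
    from their difference.\<close>
  define C where "C x = (a + c * (2 * A (norm x + 1))) * B" for x :: "real^'d"
  have der0: "((\<lambda>y. f (X y w)) has_derivative (\<lambda>v. grad f (X x w) \<bullet> XD x v w)) (at x)" for x w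
    by (rule has_derivative_compose[OF X_has_derivative has_derivative_grad[OF diff]])
  have bd: "\<bar>f (X y w) - f (X x w)\<bar> \<le> C x * (weight w)\<^sup>2 * norm (y - x)" if y: "y \<in> ball x 1" for x y w
  proof -
    have ny: "norm y \<le> norm x + 1"
      using y norm_triangle_ineq2[of y x] by (simp add: dist_norm norm_minus_commute)
    have Amono: "A (norm y) \<le> A (norm x + 1)" "A (norm x) \<le> A (norm x + 1)"
      unfolding A_def using B ny by (auto intro!: mult_left_mono)
    have "norm (X y w) + norm (X x w) \<le> 2 * A (norm x + 1) * weight w"
      using A[of y w] A[of x w] mult_right_mono[OF Amono(1) wt(1)[of w]] mult_right_mono[OF Amono(2) wt(1)[of w]]
      by linarith
    then have "\<bar>f (X y w) - f (X x w)\<bar> \<le> (a * weight w + c * (2 * A (norm x + 1) * weight w)) * (B * norm (y - x) * weight w)"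
      unfolding B_def using c wt a_wt[of w] A_nonneg[of "norm x + 1"] a
      by (intro order_trans[OF f_diff] mult_mono[OF add_mono norm_X_diff_le] mult_left_mono) auto
    also have "\<dots> = C x * (weight w)\<^sup>2 * norm (y - x)"
      by (simp add: C_def algebra_simps power2_eq_square)
    finally show ?thesis .
  qed
  have intC: "integrable noise_law (\<lambda>w. C x * (weight w)\<^sup>2)" for x
    by (intro integrable_mult_right integrable_weight_square)
  have int': "integrable noise_law (\<lambda>w. grad f (X x w) \<bullet> XD x v w)" for x v
    by (rule integrable_derivative_dominated[OF zero_less_one int_f der0 intC bd])
  have der: "(P f has_derivative (\<lambda>v. \<integral>w. grad f (X x w) \<bullet> XD x v w \<partial>noise_law)) (at x)" for x
    unfolding P_def by (rule has_derivative_integral_dominated[OF zero_less_one int_f der0 intC bd])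
  show "integrable noise_law (\<lambda>w. grad f (X x w) \<bullet> XD x v w)" by (rule int')
  from der show "(P f has_derivative (\<lambda>v. \<integral>w. grad f (X x w) \<bullet> XD x v w \<partial>noise_law)) (at x)" .
  let ?E = "\<integral>w. (weight w)\<^sup>2 \<partial>(noise_law :: ((real^'q) \<times> bool \<times> real) measure)"
  have E: "0 \<le> ?E" by simp
  have c1: "0 \<le> (a + c * X_offset) * B * ?E" and c2: "0 \<le> c * B * B * ?E"
    by (intro mult_nonneg_nonneg add_nonneg_nonneg a c B E X_offset_nonneg)+
  have nonneg: "0 \<le> (a + c * X_offset) * B * ?E + c * B * B * ?E * norm x" for x :: "real^'d"
    by (intro add_nonneg_nonneg mult_nonneg_nonneg[OF c2] c1) simp
  have "norm (grad (P f) x) \<le> (a + c * X_offset) * B * ?E + c * B * B * ?E * norm x" for x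
  proof -
    \<comment> \<open>In the direction of the gradient itself the derivative formula yields its
      squared norm.\<close>
    let ?v = "grad (P f) x"
    have "?v \<bullet> ?v = (\<integral>w. grad f (X x w) \<bullet> XD x ?v w \<partial>noise_law)"
      by (rule grad_inner_eq[OF der])
    also have "\<dots> \<le> (\<integral>w. (a + c * A (norm x)) * B * norm ?v * (weight w)\<^sup>2
        \<partial>(noise_law :: ((real^'q) \<times> bool \<times> real) measure))"
    proof (rule integral_mono)
      fix w
      have "grad f (X x w) \<bullet> XD x ?v w \<le> norm (grad f (X x w)) * norm (XD x ?v w)"
        by (rule norm_cauchy_schwarz)
      also have "\<dots> \<le> (a * weight w + c * (A (norm x) * weight w)) * (B * norm ?v * weight w)"
        unfolding B_def using c wt a_wt[of w] A[of x w] A_nonneg[of "norm x"] a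
        by (intro mult_mono[OF order_trans[OF growth add_mono] norm_XD_le] mult_left_mono) auto
      finally show "grad f (X x w) \<bullet> XD x ?v w \<le> (a + c * A (norm x)) * B * norm ?v * (weight w)\<^sup>2"
        by (simp add: algebra_simps power2_eq_square)
    qed (intro int' integrable_mult_right integrable_weight_square)+
    also have "\<dots> = ((a + c * X_offset) * B * ?E + c * B * B * ?E * norm x) * norm ?v"
      unfolding integral_mult_right_zero A_def by (simp add: algebra_simps)
    finally have "norm ?v * norm ?v \<le> ((a + c * X_offset) * B * ?E + c * B * B * ?E * norm x) * norm ?v"
      by (simp add: dot_square_norm power2_eq_square)
    then show ?thesis
      using nonneg[of x] by (cases "norm ?v = 0") (auto simp: mult_le_cancel_right)
  qed
  moreover have "P f differentiable (at x)" for x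
    using der differentiable_def by blast
  ultimately show "grad_linear_growth (P f)"
    unfolding grad_linear_growth_def using c1 c2 by blast
qed

lemma P_Lipschitz:
  assumes f: "grad_linear_growth f" and K: "0 \<le> K" and lip: "\<And>x y. \<bar>f x - f y\<bar> \<le> K * norm (x - y)"
  shows "\<bar>P f x - P f y\<bar> \<le> flow_bound * K * norm (x - y)"
proof (cases "x = y")
  case True then show ?thesis by simp
next
  case False
  let ?d = "norm (x - y)"
  have d: "?d > 0" using False by simp
  have "\<bar>P f x - P f y\<bar> = \<bar>\<integral>w. f (X x w) - f (X y w) \<partial>noise_law\<bar>"
    unfolding P_def by (simp add: Bochner_Integration.integral_diff[OF integrable_X[OF f] integrable_X[OF f]])
  \<comment> \<open>Young's inequality with t = 1 and a = |x - y|: the first moment of the increment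
    is bounded through its second moment.\<close>
  also have "\<dots> \<le> (\<integral>w. K * (((norm (X x w - X y w))\<^sup>2 / ?d + ?d) / 2) \<partial>noise_law)"
  proof (rule abs_integral_le)
    fix w
    have "\<bar>f (X x w) - f (X y w)\<bar> \<le> K * (norm (X x w - X y w) * 1)"
      using lip[of "X x w" "X y w"] by simp
    also have "\<dots> \<le> K * (((norm (X x w - X y w))\<^sup>2 / ?d + ?d * 1\<^sup>2) / 2)"
      by (intro mult_left_mono mult_le_weighted_squares d K)
    finally show "\<bar>f (X x w) - f (X y w)\<bar> \<le> K * (((norm (X x w - X y w))\<^sup>2 / ?d + ?d) / 2)"
      by simp
    show "integrable noise_law (\<lambda>w. f (X x w) - f (X y w))"
      by (intro Bochner_Integration.integrable_diff integrable_X[OF f])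
    show "integrable noise_law (\<lambda>w. K * (((norm (X x w - X y w))\<^sup>2 / ?d + ?d) / 2))"
      by (intro integrable_mult_right integrable_divide_zero Bochner_Integration.integrable_add
          integrable_X_diff_square) simp
  qed
  also have "\<dots> = K * (((\<integral>w. (norm (X x w - X y w))\<^sup>2 \<partial>noise_law) / ?d + ?d) / 2)"
    unfolding integral_mult_right_zero integral_divide_zero
    by (subst Bochner_Integration.integral_add)
      (auto intro: integrable_X_diff_square simp: gauss_jumps.P.prob_space)
  also have "\<dots> \<le> K * (((flow_bound * ?d\<^sup>2) / ?d + ?d) / 2)"
    by (intro mult_left_mono divide_right_mono add_right_mono X_diff_square_le K) auto
  also have "\<dots> = K * ((flow_bound * ?d + ?d) / 2)"
    by (simp add: power2_eq_square)
  \<comment> \<open>(F + 1) / 2 <= F because F = \<open>flow_bound\<close> is at least 1.\<close>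
  also have "\<dots> \<le> K * (flow_bound * ?d)"
    using mult_right_mono[OF flow_bound_ge_1, of ?d] by (intro mult_left_mono K) (simp add: mult.commute)
  finally show ?thesis by (simp add: mult_ac)
qed

text \<open>B depends on x, since the second derivatives of \<open>\<sigma>\<close> and
  \<open>\<gamma>\<close> may be unbounded. It is used only to justify a second differentiation at x
  and does not enter the final constants.\<close>

lemma XD_locally_Lipschitz:
  obtains r B where "r > 0" "B \<ge> 0"
    "\<And>y v w. y \<in> ball x r \<Longrightarrow> norm (XD y v w - XD x v w) \<le> B * norm v * norm (y - x) * weight w"
proof -
  obtain r1 B1 where 1: "r1 > 0" "B1 \<ge> 0" "\<And>y. y \<in> ball x r1 \<Longrightarrow> norm (D1 b y - D1 b x) \<le> B1 * norm (y - x)"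
    using has_derivative_locally_Lipschitz[OF twice_differentiable_D2[OF b2]] by metis
  obtain r2 B2 where 2: "r2 > 0" "B2 \<ge> 0" "\<And>y. y \<in> ball x r2 \<Longrightarrow> norm (D1 \<sigma> y - D1 \<sigma> x) \<le> B2 * norm (y - x)"
    using has_derivative_locally_Lipschitz[OF twice_differentiable_D2[OF s2]] by metis
  obtain r3 B3 where 3: "r3 > 0" "B3 \<ge> 0" "\<And>y. y \<in> ball x r3 \<Longrightarrow> norm (D1 \<gamma> y - D1 \<gamma> x) \<le> B3 * norm (y - x)"
    using has_derivative_locally_Lipschitz[OF twice_differentiable_D2[OF g2]] by metis
  show ?thesis
  proof (rule that[of "min r1 (min r2 r3)" "h * B1 + sqrt h * B2 + B3"])
    fix y v :: "real^'d" and w :: "(real^'q) \<times> bool \<times> real" assume y: "y \<in> ball x (min r1 (min r2 r3))"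
    let ?n = "norm v * norm (y - x)"
    have eq: "XD y v w - XD x v w = h *\<^sub>R blinfun_apply (D1 b y - D1 b x) v + (sqrt h *\<^sub>R blinfun_apply (D1 \<sigma> y - D1 \<sigma> x) v) *v fst w
        + jump (snd w) *\<^sub>R blinfun_apply (D1 \<gamma> y - D1 \<gamma> x) v"
      by (simp add: XD_def blinfun.diff_left scaleR_diff_right matrix_vector_mult_diff_rdistrib algebra_simps)
    have bl: "norm (D v) \<le> B * ?n" if "norm D \<le> B * norm (y - x)"
      for D :: "(real^'d) \<Rightarrow>\<^sub>L 'e::real_normed_vector" and B
      using order_trans[OF norm_blinfun mult_right_mono[OF that]] by (simp add: mult_ac)
    have n1: "norm (h *\<^sub>R blinfun_apply (D1 b y - D1 b x) v) \<le> h * (B1 * ?n)"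
      using bl[OF 1(3)] y h by simp
    have n2: "norm (sqrt h *\<^sub>R blinfun_apply (D1 \<sigma> y - D1 \<sigma> x) v) \<le> sqrt h * (B2 * ?n)"
      using bl[OF 2(3)] y h by simp
    have n3: "norm (blinfun_apply (D1 \<gamma> y - D1 \<gamma> x) v) \<le> B3 * ?n"
      using bl[OF 3(3)] y by simp
    have "norm (XD y v w - XD x v w) \<le> (norm (h *\<^sub>R blinfun_apply (D1 b y - D1 b x) v) + norm (sqrt h *\<^sub>R blinfun_apply (D1 \<sigma> y - D1 \<sigma> x) v)
        + norm (blinfun_apply (D1 \<gamma> y - D1 \<gamma> x) v)) * weight w"
      unfolding eq by (rule norm_affine_noise_le)
    also have "\<dots> \<le> (h * (B1 * ?n) + sqrt h * (B2 * ?n) + B3 * ?n) * weight w"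
      using weight_ge_1[of w] by (intro mult_right_mono add_mono n1 n2 n3) simp
    finally show "norm (XD y v w - XD x v w) \<le> (h * B1 + sqrt h * B2 + B3) * norm v * norm (y - x) * weight w"
      by (simp add: algebra_simps)
  qed (use 1 2 3 h in auto)
qed

text \<open>The three summands come from D2 f(X)(DX u, DX v), from Stein's identity and from the
  jump estimate.\<close>

definition hessian_growth :: real
  where "hessian_growth = flow_bound + h * (real CARD('d) ^ 4 * Kss) + \<theta> * ((real CARD('d))\<^sup>2 * Kgg)"

text \<open>The drift part enters through a bound \<open>\<beta>\<close> on the pairing of the
  gradient with D2 b, so neither factor has to be bounded by itself.\<close>

lemma abs_integral_grad_XDD_le:
  assumes lip: "L-lipschitz_on UNIV (grad f)" and diff: "\<And>x. grad f differentiable (at x)"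
    and \<beta>: "\<And>x y u v. \<bar>grad f y \<bullet> D2 b x u v\<bar> \<le> \<beta> * (norm u * norm v)"
  shows "\<bar>\<integral>w. grad f (X x w) \<bullet> XDD x u v w \<partial>noise_law\<bar> \<le>
    (L * (h * (real CARD('d) ^ 4 * Kss) + \<theta> * ((real CARD('d))\<^sup>2 * Kgg)) + h * \<beta>) * (norm u * norm v)"
proof -
  have L: "0 \<le> L" using lip lipschitz_on_nonneg by blast
  let ?n = "norm u * norm v"
  let ?S = "sqrt h *\<^sub>R \<sigma> x" and ?A = "sqrt h *\<^sub>R D2 \<sigma> x u v" and ?e = "D2 \<gamma> x u v"
  note int = integrable_noise_inner_affine[OF lip, of "x + h *\<^sub>R b x" ?S "\<gamma> x", folded X_def]
  have i1: "integrable noise_law (\<lambda>w. grad f (X x w) \<bullet> (h *\<^sub>R D2 b x u v))"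
    using int[of "h *\<^sub>R D2 b x u v" 0 0] by simp
  have i2: "integrable noise_law (\<lambda>w. grad f (X x w) \<bullet> (?A *v fst w))"
    using int[of 0 ?A 0] by simp
  have i3: "integrable noise_law (\<lambda>w. grad f (X x w) \<bullet> (jump (snd w) *\<^sub>R ?e))"
    using int[of 0 0 ?e] by simp
  have eq: "(\<integral>w. grad f (X x w) \<bullet> XDD x u v w \<partial>noise_law) =
      (\<integral>w. grad f (X x w) \<bullet> (h *\<^sub>R D2 b x u v) \<partial>noise_law) +
      (\<integral>w. grad f (X x w) \<bullet> (?A *v fst w) \<partial>noise_law) +
      (\<integral>w. grad f (X x w) \<bullet> (jump (snd w) *\<^sub>R ?e) \<partial>noise_law)"
    unfolding XDD_def inner_add_right
    by (simp only: Bochner_Integration.integral_add[OF Bochner_Integration.integrable_add[OF i1 i2] i3]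
        Bochner_Integration.integral_add[OF i1 i2])
  have 1: "\<bar>\<integral>w. grad f (X x w) \<bullet> (h *\<^sub>R D2 b x u v) \<partial>noise_law\<bar> \<le> h * (\<beta> * ?n)"
  proof -
    have "\<bar>\<integral>w. grad f (X x w) \<bullet> (h *\<^sub>R D2 b x u v) \<partial>noise_law\<bar> \<le>
        (\<integral>w. h * (\<beta> * ?n) \<partial>(noise_law :: ((real^'q) \<times> bool \<times> real) measure))"
      by (rule abs_integral_le[OF i1]) (use \<beta> h in \<open>auto simp: abs_mult\<close>)
    then show ?thesis by (simp add: gauss_jumps.P.prob_space)
  qed
  have 2: "\<bar>\<integral>w. grad f (X x w) \<bullet> (?A *v fst w) \<partial>noise_law\<bar> \<le> L * (h * (real CARD('d) ^ 4 * Kss * ?n))"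
  proof -
    \<comment> \<open>One sqrt h comes from the second derivative of the step, the other from the
      Gaussian part of the step itself, released by Stein's identity; together they give the order
      h.\<close>
    have ss: "sqrt h * (sqrt h * c) = h * c" for c
      using h by (simp flip: mult.assoc)
    have "?A ** transpose ?S = h *\<^sub>R (D2 \<sigma> x u v ** transpose (\<sigma> x))"
      by (simp add: vec_eq_iff matrix_matrix_mult_def transpose_def sum_distrib_left mult_ac ss)
    then have "(\<Sum>k\<in>UNIV. \<Sum>m\<in>UNIV. \<bar>(?A ** transpose ?S) $ k $ m\<bar>) =
        h * (\<Sum>k\<in>UNIV. \<Sum>m\<in>UNIV. \<bar>(D2 \<sigma> x u v ** transpose (\<sigma> x)) $ k $ m\<bar>)"
      using h by (simp add: abs_mult sum_distrib_left)
    also have "\<dots> \<le> h * (real CARD('d) ^ 4 * Kss * ?n)"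
      using h by (intro mult_left_mono D2_mult_transpose_entries_le Dss) auto
    finally have "L * (\<Sum>k\<in>UNIV. \<Sum>m\<in>UNIV. \<bar>(?A ** transpose ?S) $ k $ m\<bar>) \<le>
        L * (h * (real CARD('d) ^ 4 * Kss * ?n))"
      using L by (rule mult_left_mono)
    then show ?thesis
      unfolding X_def by (rule order_trans[OF noise_Stein_bound[OF lip diff]])
  qed
  have 3: "\<bar>\<integral>w. grad f (X x w) \<bullet> (jump (snd w) *\<^sub>R ?e) \<partial>noise_law\<bar> \<le> L * \<theta> * ((real CARD('d))\<^sup>2 * Kgg * ?n)"
  proof -
    have "L * \<theta> * (norm (\<gamma> x) * norm ?e) \<le> L * \<theta> * ((real CARD('d))\<^sup>2 * Kgg * ?n)"
      using L \<theta>_nonneg by (intro mult_left_mono norm_mult_D2_le Dgg) auto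
    then show ?thesis
      unfolding X_def \<theta>_def by (rule order_trans[OF noise_jump_bound[OF lip]])
  qed
  show ?thesis
    unfolding eq using 1 2 3 by (simp add: algebra_simps)
qed

lemma
  assumes diff: "\<And>x. f differentiable (at x)" and diff2: "\<And>x. grad f differentiable (at x)"
    and lip: "L-lipschitz_on UNIV (grad f)"
    and \<beta>: "\<And>x y u v. \<bar>grad f y \<bullet> D2 b x u v\<bar> \<le> \<beta> * (norm u * norm v)"
  shows grad_P_differentiable: "grad (P f) differentiable (at x)"
    and grad_P_Lipschitz: "(hessian_growth * L + h * \<beta>)-lipschitz_on UNIV (grad (P f))"
proof -
  have L: "0 \<le> L" using lip lipschitz_on_nonneg by blast
  have lipn: "norm (grad f y - grad f x) \<le> L * norm (y - x)" for x y
    using lipschitz_onD[OF lip, of y x] by (simp add: dist_norm)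
  note growth = grad_linear_growth_of_Lipschitz[OF diff lip]
  define H where "H q = frechet_derivative (grad f) (at q)" for q
  have H: "(grad f has_derivative H q) (at q)" for q
    unfolding H_def using diff2 frechet_derivative_works by blast
  have H_le: "norm (H q v) \<le> L * norm v" for q v
    by (rule has_derivative_norm_le_Lipschitz[OF H lipn])
  define F' where "F' v x w u = grad f (X x w) \<bullet> XDD x u v w + H (X x w) (XD x u w) \<bullet> XD x v w" for v x w u
  have "((\<lambda>y. grad f (X y w) \<bullet> XD y v w) has_derivative F' v x w) (at x)" for v x w
    unfolding F'_def
    by (rule has_derivative_inner[OF has_derivative_compose[OF X_has_derivative H] XD_has_derivative])
  note der0 = this
  \<comment> \<open>r and K may depend on x and v: the integral is differentiated at one point and
    for one direction at a time.\<close>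
  have dom: "\<exists>r>0. \<exists>K. \<forall>y\<in>ball x r. \<forall>w. \<bar>grad f (X y w) \<bullet> XD y v w - grad f (X x w) \<bullet> XD x v w\<bar> \<le>
      K * (weight w)\<^sup>2 * norm (y - x)" for x v
  proof -
    obtain r B where r: "r > 0" and B: "B \<ge> 0"
      and XDl: "\<And>y v w. y \<in> ball x r \<Longrightarrow> norm (XD y v w - XD x v w) \<le> B * norm v * norm (y - x) * weight w"
      using XD_locally_Lipschitz[of x] by metis
    define G where "G = norm (grad f 0) + L * (norm (x + h *\<^sub>R b x) + norm (sqrt h *\<^sub>R \<sigma> x) + norm (\<gamma> x))"
    have G: "norm (grad f (X x w)) \<le> G * weight w" for w
      unfolding X_def G_def by (rule noise_Lipschitz_growth[OF lip])
    have "\<bar>grad f (X y w) \<bullet> XD y v w - grad f (X x w) \<bullet> XD x v w\<bar> \<le>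
      (L * pathwise_bound * pathwise_bound * norm v + G * B * norm v) * (weight w)\<^sup>2 * norm (y - x)"
      if y: "y \<in> ball x r" for y w
    proof -
      have wt: "0 \<le> weight w" using weight_ge_1[of w] by simp
      have G0: "0 \<le> G" using L by (simp add: G_def)
      have "grad f (X y w) \<bullet> XD y v w - grad f (X x w) \<bullet> XD x v w =
          (grad f (X y w) - grad f (X x w)) \<bullet> XD y v w + grad f (X x w) \<bullet> (XD y v w - XD x v w)"
        by (simp add: inner_diff_left inner_diff_right)
      then have "\<bar>grad f (X y w) \<bullet> XD y v w - grad f (X x w) \<bullet> XD x v w\<bar> \<le>
          norm (grad f (X y w) - grad f (X x w)) * norm (XD y v w) + norm (grad f (X x w)) * norm (XD y v w - XD x v w)"
        using Cauchy_Schwarz_ineq2[of "grad f (X y w) - grad f (X x w)" "XD y v w"]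
          Cauchy_Schwarz_ineq2[of "grad f (X x w)" "XD y v w - XD x v w"] by linarith
      also have "\<dots> \<le> (L * (pathwise_bound * norm (y - x) * weight w)) * (pathwise_bound * norm v * weight w) +
          (G * weight w) * (B * norm v * norm (y - x) * weight w)"
        using L wt G0 pathwise_bound_nonneg
        by (intro add_mono mult_mono order_trans[OF lipn mult_left_mono[OF norm_X_diff_le]] norm_XD_le G XDl[OF y]) auto
      finally show ?thesis by (simp add: algebra_simps power2_eq_square)
    qed
    with r show ?thesis by blast
  qed
  have "integrable noise_law (\<lambda>w. F' v x w u) \<and>
      ((\<lambda>y. \<integral>w. grad f (X y w) \<bullet> XD y v w \<partial>noise_law) has_derivative (\<lambda>u. \<integral>w. F' v x w u \<partial>noise_law)) (at x)" for v x u
  proof -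
    obtain r K where r: "r > 0" and K: "\<And>y w. y \<in> ball x r \<Longrightarrow>
        \<bar>grad f (X y w) \<bullet> XD y v w - grad f (X x w) \<bullet> XD x v w\<bar> \<le> (K * (weight w)\<^sup>2) * norm (y - x)"
      using dom[of x v] by blast
    have intK: "integrable noise_law (\<lambda>w :: (real^'q) \<times> bool \<times> real. K * (weight w)\<^sup>2)"
      by (intro integrable_mult_right integrable_weight_square)
    show ?thesis
      by (intro conjI integrable_derivative_dominated[OF r integrable_grad_XD[OF growth] der0 intK K]
          has_derivative_integral_dominated[OF r integrable_grad_XD[OF growth] der0 intK K])
  qed
  then have intF': "integrable noise_law (\<lambda>w. F' v x w u)"
    and "((\<lambda>y. \<integral>w. grad f (X y w) \<bullet> XD y v w \<partial>noise_law) has_derivative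
      (\<lambda>u. \<integral>w. F' v x w u \<partial>noise_law)) (at x)" for v x u
    by blast+
  then have der: "((\<lambda>y. grad (P f) y \<bullet> v) has_derivative (\<lambda>u. \<integral>w. F' v x w u \<partial>noise_law)) (at x)" for v x
    by (simp add: grad_inner_eq[OF P_has_derivative[OF growth]])
  show "grad (P f) differentiable (at x)"
    unfolding differentiable_componentwise_within[of "grad (P f)"]
    using der differentiable_def by blast
  let ?\<Lambda> = "hessian_growth * L + h * \<beta>"
  have F'_le: "\<bar>\<integral>w. F' v x w u \<partial>noise_law\<bar> \<le> ?\<Lambda> * (norm u * norm v)" for v x u
  proof (cases "u = 0 \<or> v = 0")
    case True
    have "linear (\<lambda>u. \<integral>w. F' v x w u \<partial>noise_law)"
      using der has_derivative_linear by blast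
    then have "u = 0 \<Longrightarrow> (\<integral>w. F' v x w u \<partial>noise_law) = 0"
      using linear_0 by blast
    moreover have "v = 0 \<Longrightarrow> (\<lambda>w. F' v x w u) = (\<lambda>w. 0)"
      by (simp add: F'_def XD_def XDD_def)
    ultimately show ?thesis using True by auto
  next
    case False
    have X2: "integrable noise_law (\<lambda>w. grad f (X x w) \<bullet> XDD x u v w)"
      unfolding X_def XDD_def by (rule integrable_noise_inner_affine[OF lip])
    \<comment> \<open>Integrability, and with it measurability, of the Hessian term is obtained by
      subtraction from \<open>F'\<close>, whose integrability came with the differentiation.\<close>
    then have H2: "integrable noise_law (\<lambda>w. H (X x w) (XD x u w) \<bullet> XD x v w)"
      using Bochner_Integration.integrable_diff[OF intF'[of v x u] X2] by (simp add: F'_def)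
    \<comment> \<open>This choice makes the two bounds for the weighted squares equal, so that their
      mean is a multiple of |u| |v|. It is why u = 0 or v = 0 was split off.\<close>
    define a where "a = norm u / norm v"
    have a: "0 < a" using False by (simp add: a_def)
    have iq: "integrable noise_law (\<lambda>w. L * (((norm (XD x u w))\<^sup>2 / a + a * (norm (XD x v w))\<^sup>2) / 2))"
      by (intro integrable_mult_right integrable_divide_zero Bochner_Integration.integrable_add integrable_XD_square)
    have "\<bar>\<integral>w. H (X x w) (XD x u w) \<bullet> XD x v w \<partial>noise_law\<bar> \<le>
        (\<integral>w. L * (((norm (XD x u w))\<^sup>2 / a + a * (norm (XD x v w))\<^sup>2) / 2) \<partial>noise_law)"
    proof (rule abs_integral_le[OF H2 iq])
      fix w
      have "\<bar>H (X x w) (XD x u w) \<bullet> XD x v w\<bar> \<le> norm (H (X x w) (XD x u w)) * norm (XD x v w)"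
        by (rule Cauchy_Schwarz_ineq2)
      also have "\<dots> \<le> (L * norm (XD x u w)) * norm (XD x v w)"
        by (intro mult_right_mono H_le) simp
      also have "\<dots> \<le> L * (((norm (XD x u w))\<^sup>2 / a + a * (norm (XD x v w))\<^sup>2) / 2)"
        unfolding mult.assoc by (intro mult_left_mono mult_le_weighted_squares a L)
      finally show "\<bar>H (X x w) (XD x u w) \<bullet> XD x v w\<bar> \<le> L * (((norm (XD x u w))\<^sup>2 / a + a * (norm (XD x v w))\<^sup>2) / 2)" .
    qed
    also have "\<dots> = L * (((\<integral>w. (norm (XD x u w))\<^sup>2 \<partial>noise_law) / a + a * (\<integral>w. (norm (XD x v w))\<^sup>2 \<partial>noise_law)) / 2)"
      unfolding integral_mult_right_zero integral_divide_zero
      by (subst Bochner_Integration.integral_add) (auto intro: integrable_XD_square)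
    also have "\<dots> \<le> L * (((flow_bound * (norm u)\<^sup>2) / a + a * (flow_bound * (norm v)\<^sup>2)) / 2)"
      using a by (intro mult_left_mono divide_right_mono add_mono XD_square_le L) auto
    also have "\<dots> = L * flow_bound * (norm u * norm v)"
      using False by (simp add: a_def power2_eq_square)
    finally have 1: "\<bar>\<integral>w. H (X x w) (XD x u w) \<bullet> XD x v w \<partial>noise_law\<bar> \<le> L * flow_bound * (norm u * norm v)" .
    have "(\<integral>w. F' v x w u \<partial>noise_law) = (\<integral>w. grad f (X x w) \<bullet> XDD x u v w \<partial>noise_law) +
        (\<integral>w. H (X x w) (XD x u w) \<bullet> XD x v w \<partial>noise_law)"
      unfolding F'_def by (rule Bochner_Integration.integral_add[OF X2 H2])
    then show ?thesis
      using 1 abs_integral_grad_XDD_le[OF lip diff2 \<beta>, of x u v]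
      by (simp add: hessian_growth_def algebra_simps)
  qed
  \<comment> \<open>No sign is assumed for \<open>\<beta>\<close>; a unit vector in both arguments
    of the bound shows that the constant is nonnegative.\<close>
  have \<Lambda>: "0 \<le> ?\<Lambda>"
    using order_trans[OF abs_ge_zero F'_le[of "axis undefined 1" 0 "axis undefined 1"]] by (simp add: norm_axis_1)
  have "norm (grad (P f) y - grad (P f) x) \<le> ?\<Lambda> * norm (y - x)" for x y
  proof -
    \<comment> \<open>The mean value inequality is applied to the scalar function obtained by
      pairing the gradient with this fixed increment.\<close>
    let ?v = "grad (P f) y - grad (P f) x"
    have "norm (grad (P f) y \<bullet> ?v - grad (P f) x \<bullet> ?v) \<le> (?\<Lambda> * norm ?v) * norm (y - x)"
    proof (rule differentiable_bound[of UNIV _ "\<lambda>x u. \<integral>w. F' ?v x w u \<partial>noise_law"])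
      show "onorm (\<lambda>u. \<integral>w. F' ?v z w u \<partial>noise_law) \<le> ?\<Lambda> * norm ?v" for z
        by (rule onorm_le) (use F'_le[of ?v z] in \<open>simp add: mult_ac\<close>)
    qed (use der in auto)
    then have "norm ?v * norm ?v \<le> (?\<Lambda> * norm (y - x)) * norm ?v"
      by (simp add: inner_diff_left[symmetric] dot_square_norm power2_eq_square mult_ac)
    with \<Lambda> show ?thesis
      by (cases "norm ?v = 0") (auto simp: mult_le_cancel_right)
  qed
  with \<Lambda> show "?\<Lambda>-lipschitz_on UNIV (grad (P f))"
    by (intro lipschitz_onI) (auto simp: dist_norm)
qed

end

section \<open>Extended Lipschitz constants and iteration\<close>


lemma Lip_const_leI:
  assumes "\<And>x y. dist (g x) (g y) \<le> K * dist x y"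
  shows "Lip_const g \<le> ennreal K"
  unfolding Lip_const_def
proof (intro SUP_least)
  fix x y :: 'a assume "y \<in> - {x}"
  then have "dist x y > 0" by simp
  with assms[of x y] show "ennreal (dist (g x) (g y) / dist x y) \<le> ennreal K"
    by (intro ennreal_leI) (simp add: pos_divide_le_eq)
qed

lemma dist_le_Lip_const:
  assumes "Lip_const g < \<infinity>"
  shows "dist (g x) (g y) \<le> enn2real (Lip_const g) * dist x y"
proof (cases "x = y")
  case False
  then have "ennreal (dist (g x) (g y) / dist x y) \<le> Lip_const g"
    unfolding Lip_const_def by (intro SUP_upper2[of x] SUP_upper2[of y]) auto
  with assms have "dist (g x) (g y) / dist x y \<le> enn2real (Lip_const g)"
    using enn2real_mono by fastforce
  with False show ?thesis by (simp add: pos_divide_le_eq)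
qed simp

lemma Lip_const_lipschitz_on:
  assumes "Lip_const g < \<infinity>"
  shows "(enn2real (Lip_const g))-lipschitz_on UNIV g"
  by (rule lipschitz_onI) (use dist_le_Lip_const[OF assms] in auto)

lemma Lip_const_le_of_lipschitz_on: "K-lipschitz_on UNIV g \<Longrightarrow> Lip_const g \<le> ennreal K"
  by (rule Lip_const_leI) (simp add: lipschitz_onD)

lemma norm_le_sup_norm: "ennreal (norm (g x)) \<le> sup_norm g"
  unfolding sup_norm_def by (rule SUP_upper) simp

text \<open>Through this identity the Lipschitz estimate for \<open>P f\<close> also bounds the sup
  norm of its gradient, as the iteration requires.\<close>

lemma sup_norm_grad_eq_Lip_const:
  fixes f :: "real^'d::finite \<Rightarrow> real"
  assumes diff: "\<And>x. f differentiable (at x)"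
  shows "sup_norm (grad f) = Lip_const f"
proof (rule antisym)
  show "sup_norm (grad f) \<le> Lip_const f"
  proof (cases "Lip_const f < \<infinity>")
    case True
    let ?K = "enn2real (Lip_const f)"
    have "norm (grad f x) \<le> ?K" for x
    proof -
      let ?v = "grad f x"
      have "norm (?v \<bullet> ?v) \<le> ?K * norm ?v"
        by (rule has_derivative_norm_le_Lipschitz[OF has_derivative_grad[OF diff]])
          (use dist_le_Lip_const[OF True] in \<open>simp add: dist_norm\<close>)
      then have "norm ?v * norm ?v \<le> ?K * norm ?v"
        by (simp add: dot_square_norm power2_eq_square)
      then show ?thesis
        by (cases "norm ?v = 0") (auto simp: mult_le_cancel_right)
    qed
    then have "sup_norm (grad f) \<le> ennreal ?K"
      unfolding sup_norm_def by (intro SUP_least ennreal_leI)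
    with True show ?thesis by simp
  next
    case False
    then have "Lip_const f = top" by (simp add: less_top[symmetric])
    then show ?thesis by simp
  qed
  show "Lip_const f \<le> sup_norm (grad f)"
  proof (cases "sup_norm (grad f) < \<infinity>")
    case True
    let ?K = "enn2real (sup_norm (grad f))"
    have K: "norm (grad f x) \<le> ?K" for x
      using enn2real_mono[OF norm_le_sup_norm[of "grad f" x]] True by simp
    have "norm (f y - f x) \<le> ?K * norm (y - x)" for x y
    proof (rule differentiable_bound[of UNIV f "\<lambda>x v. grad f x \<bullet> v"])
      show "onorm (\<lambda>v. grad f z \<bullet> v) \<le> ?K" for z
        by (rule onorm_le)
          (use order_trans[OF Cauchy_Schwarz_ineq2 mult_right_mono[OF K]] in auto)
    qed (use has_derivative_grad[OF diff] in auto)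
    then have "Lip_const f \<le> ennreal ?K"
      by (intro Lip_const_leI) (simp add: dist_norm)
    with True show ?thesis by simp
  next
    case False
    then have "sup_norm (grad f) = top" by (simp add: less_top[symmetric])
    then show ?thesis by simp
  qed
qed

lemma norm_D2_le_D2_sup:
  "ennreal (norm (D2 g x u v)) \<le> ennreal (norm u * norm v) * D2_sup g"
proof (cases "u = 0 \<or> v = 0")
  case False
  let ?u = "u /\<^sub>R norm u" and ?v = "v /\<^sub>R norm v"
  have "ennreal (norm (D2 g x ?u ?v)) \<le> D2_sup g"
    unfolding D2_sup_def using False
    by (intro SUP_upper2[of x] SUP_upper2[of ?u] SUP_upper2[of ?v]) auto
  then have "ennreal (norm u * norm v) * ennreal (norm (D2 g x ?u ?v)) \<le> ennreal (norm u * norm v) * D2_sup g"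
    by (rule mult_left_mono) simp
  moreover have "norm (D2 g x u v) = (norm u * norm v) * norm (D2 g x ?u ?v)"
    using False by (simp add: blinfun.bilinear_simps field_simps)
  ultimately show ?thesis by (simp add: ennreal_mult)
qed (auto simp: blinfun.bilinear_simps)

text \<open>The computation stays in [0, infinity] because only the product is known to be finite:
  \<open>D2_sup g\<close> may be 0 with G unbounded, and conversely.\<close>

lemma abs_grad_D2_le:
  assumes "D2_sup g * sup_norm G < \<infinity>"
  shows "\<bar>G y \<bullet> D2 g x u v\<bar> \<le> enn2real (D2_sup g * sup_norm G) * (norm u * norm v)"
proof -
  have "ennreal \<bar>G y \<bullet> D2 g x u v\<bar> \<le> ennreal (norm (D2 g x u v) * norm (G y))"
    using Cauchy_Schwarz_ineq2[of "G y" "D2 g x u v"] by (intro ennreal_leI) (simp add: mult.commute)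
  also have "\<dots> = ennreal (norm (D2 g x u v)) * ennreal (norm (G y))"
    by (simp add: ennreal_mult)
  also have "\<dots> \<le> (ennreal (norm u * norm v) * D2_sup g) * sup_norm G"
    by (intro mult_mono norm_D2_le_D2_sup norm_le_sup_norm) auto
  also have "\<dots> = ennreal (norm u * norm v) * (D2_sup g * sup_norm G)"
    by (simp add: mult.assoc)
  also have "D2_sup g * sup_norm G = ennreal (enn2real (D2_sup g * sup_norm G))"
    using assms by simp
  also have "ennreal (norm u * norm v) * ennreal (enn2real (D2_sup g * sup_norm G)) =
      ennreal (enn2real (D2_sup g * sup_norm G) * (norm u * norm v))"
    by (simp add: ennreal_mult mult.commute)
  finally show ?thesis by (subst (asm) ennreal_le_iff) auto
qed

text \<open>Each coordinate of the gradient is \<open>D1 f\<close> evaluated at a fixed axis vector,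
  a bounded linear operation on \<open>D1 f\<close>.\<close>

lemma grad_differentiable:
  fixes f :: "real^'d::finite \<Rightarrow> real"
  assumes "twice_differentiable f"
  shows "grad f differentiable (at x)"
proof -
  have "D1 f y (axis i 1) = grad f y $ i" for y i
    using frechet_derivative_at[OF twice_differentiable_D1[OF assms, of y]] by (simp add: grad_def)
  then have "grad f = (\<lambda>y. \<Sum>i\<in>UNIV. D1 f y (axis i 1) *\<^sub>R axis i 1)"
    using basis_expansion[of "grad f y" for y] by (simp add: fun_eq_iff scalar_mult_eq_scaleR)
  moreover have "(\<lambda>y. \<Sum>i\<in>UNIV. D1 f y (axis i 1) *\<^sub>R (axis i 1 :: real^'d)) differentiable (at x)"
    by (intro differentiable_sum differentiable_scaleR differentiable_const finite ballI)
      (use bounded_linear.has_derivative[OF blinfun.bounded_linear_left twice_differentiable_D2[OF assms]]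
        in \<open>auto simp: differentiable_def\<close>)
  ultimately show ?thesis by simp
qed

section \<open>One step and its iterates in extended values\<close>

context euler_scheme
begin

lemma Lip_const_P_le:
  assumes f: "grad_linear_growth f"
  shows "Lip_const (P f) \<le> ennreal flow_bound * Lip_const f"
proof (cases "Lip_const f < \<infinity>")
  case True
  let ?K = "enn2real (Lip_const f)"
  have "Lip_const (P f) \<le> ennreal (flow_bound * ?K)"
  proof (rule Lip_const_leI)
    show "dist (P f x) (P f y) \<le> flow_bound * ?K * dist x y" for x y
      using P_Lipschitz[OF f, of ?K x y] dist_le_Lip_const[OF True] by (simp add: dist_norm)
  qed
  with True show ?thesis using flow_bound_ge_1 by (simp add: ennreal_mult)
next
  case False
  then have "Lip_const f = top" by (simp add: less_top[symmetric])
  then show ?thesis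
    using flow_bound_ge_1 by (simp add: ennreal_mult_top)
qed

definition regular :: "(real^'d \<Rightarrow> real) \<Rightarrow> bool"
  where "regular f \<longleftrightarrow> (\<forall>x. f differentiable (at x)) \<and> (\<forall>x. grad f differentiable (at x)) \<and>
    Lip_const (grad f) < \<infinity>"

lemma regular_grad_linear_growth: "regular f \<Longrightarrow> grad_linear_growth f"
  unfolding regular_def using grad_linear_growth_of_Lipschitz Lip_const_lipschitz_on by blast

lemma
  assumes f: "regular f" and fin: "D2_sup b * sup_norm (grad f) < \<infinity>"
  shows regular_P: "regular (P f)"
    and Lip_const_grad_P_le: "Lip_const (grad (P f)) \<le>
      ennreal hessian_growth * Lip_const (grad f) + ennreal h * (D2_sup b * sup_norm (grad f))"
proof -
  let ?L = "enn2real (Lip_const (grad f))" and ?\<beta> = "enn2real (D2_sup b * sup_norm (grad f))"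
  have diff: "\<And>x. f differentiable (at x)" and diff2: "\<And>x. grad f differentiable (at x)"
    and Lf: "Lip_const (grad f) < \<infinity>"
    using f unfolding regular_def by auto
  note lip = Lip_const_lipschitz_on[OF Lf]
  note hyps = diff diff2 lip abs_grad_D2_le[OF fin]
  have le: "Lip_const (grad (P f)) \<le> ennreal (hessian_growth * ?L + h * ?\<beta>)"
    by (rule Lip_const_le_of_lipschitz_on[OF grad_P_Lipschitz[OF hyps]])
  have "P f differentiable (at x)" for x
    using grad_linear_growth_P[OF regular_grad_linear_growth[OF f]] by (simp add: grad_linear_growth_def)
  with le grad_P_differentiable[OF hyps] show "regular (P f)"
    unfolding regular_def by (auto intro: le_less_trans)
  have "0 \<le> hessian_growth"
  proof -
    have "0 \<le> Kss" "0 \<le> Kgg"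
      using Dss Dgg op_norm_nonneg order_trans by blast+
    then show ?thesis
      unfolding hessian_growth_def using flow_bound_ge_1 h \<theta>_nonneg by simp
  qed
  then have "ennreal (hessian_growth * ?L + h * ?\<beta>) =
      ennreal hessian_growth * ennreal ?L + ennreal h * ennreal ?\<beta>"
    using h by (simp add: ennreal_plus ennreal_mult)
  with le Lf fin show "Lip_const (grad (P f)) \<le>
      ennreal hessian_growth * Lip_const (grad f) + ennreal h * (D2_sup b * sup_norm (grad f))"
    by simp
qed

lemma grad_linear_growth_funpow_P:
  "grad_linear_growth f \<Longrightarrow> grad_linear_growth ((P ^^ k) f)"
  by (induction k) (auto intro: grad_linear_growth_P)

text \<open>The three claims need each other: the source term of the next step contains the sup norm
  of the current gradient, and regularity is what allows one more step. One G dominating both growth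
  factors keeps the powers aligned.\<close>

lemma funpow_P_bounds:
  assumes f: "regular f" and fin: "D2_sup b * sup_norm (grad f) < \<infinity>"
    and G: "flow_bound \<le> G" "hessian_growth \<le> G"
  shows "regular ((P ^^ k) f) \<and>
    sup_norm (grad ((P ^^ k) f)) \<le> ennreal (G ^ k) * sup_norm (grad f) \<and>
    Lip_const (grad ((P ^^ k) f)) \<le> ennreal (G ^ k) *
      (Lip_const (grad f) + ennreal (real k * h) * (D2_sup b * sup_norm (grad f)))"
proof (induction k)
  case 0
  show ?case using f by simp
next
  case (Suc k)
  let ?g = "(P ^^ k) f" and ?S = "sup_norm (grad f)" and ?D = "D2_sup b" and ?L = "Lip_const (grad f)"
  have reg: "regular ?g" and S: "sup_norm (grad ?g) \<le> ennreal (G ^ k) * ?S"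
    and L: "Lip_const (grad ?g) \<le> ennreal (G ^ k) * (?L + ennreal (real k * h) * (?D * ?S))"
    using Suc.IH by auto
  have G1: "1 \<le> G" using G(1) flow_bound_ge_1 by linarith
  have DS: "?D * sup_norm (grad ?g) \<le> ennreal (G ^ k) * (?D * ?S)"
    using mult_left_mono[OF S, of ?D] by (simp add: mult_ac)
  \<comment> \<open>A finite power of G times a finite product: finiteness of the source term
    survives each step.\<close>
  have fin': "?D * sup_norm (grad ?g) < \<infinity>"
    using le_less_trans[OF DS, of top] fin ennreal_mult_less_top[of "ennreal (G ^ k)" "?D * ?S"] by simp
  have reg': "regular (P ?g)" by (rule regular_P[OF reg fin'])
  have diff: "\<And>x. ?g differentiable (at x)" "\<And>x. P ?g differentiable (at x)"
    using reg reg' unfolding regular_def by auto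
  have "sup_norm (grad (P ?g)) \<le> ennreal flow_bound * sup_norm (grad ?g)"
    using Lip_const_P_le[OF regular_grad_linear_growth[OF reg]] diff by (simp add: sup_norm_grad_eq_Lip_const)
  also have "\<dots> \<le> ennreal G * (ennreal (G ^ k) * ?S)"
    using G(1) S by (intro mult_mono ennreal_leI) auto
  also have "\<dots> = ennreal (G ^ Suc k) * ?S"
    using G1 by (simp add: ennreal_mult mult.assoc)
  finally have S': "sup_norm (grad (P ?g)) \<le> ennreal (G ^ Suc k) * ?S" .
  have "Lip_const (grad (P ?g)) \<le> ennreal hessian_growth * Lip_const (grad ?g) + ennreal h * (?D * sup_norm (grad ?g))"
    by (rule Lip_const_grad_P_le[OF reg fin'])
  also have "\<dots> \<le> ennreal G * (ennreal (G ^ k) * (?L + ennreal (real k * h) * (?D * ?S))) +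
      ennreal h * (ennreal (G ^ Suc k) * (?D * ?S))"
  proof (rule add_mono)
    show "ennreal hessian_growth * Lip_const (grad ?g) \<le>
        ennreal G * (ennreal (G ^ k) * (?L + ennreal (real k * h) * (?D * ?S)))"
      by (rule mult_mono[OF ennreal_leI[OF G(2)] L]) auto
    \<comment> \<open>Wasting one factor G lets G^(k+1) be taken out of both terms; what is left
      adds up to k h + h.\<close>
    have "ennreal (G ^ k) * (?D * ?S) \<le> ennreal (G ^ Suc k) * (?D * ?S)"
      using G1 by (intro mult_right_mono ennreal_leI power_increasing) auto
    with DS have "?D * sup_norm (grad ?g) \<le> ennreal (G ^ Suc k) * (?D * ?S)"
      by (rule order_trans)
    then show "ennreal h * (?D * sup_norm (grad ?g)) \<le> ennreal h * (ennreal (G ^ Suc k) * (?D * ?S))"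
      by (rule mult_left_mono) simp
  qed
  also have "\<dots> = ennreal (G ^ Suc k) * (?L + (ennreal (real k * h) + ennreal h) * (?D * ?S))"
    using G1 by (simp add: ennreal_mult distrib_left distrib_right mult_ac add_ac)
  also have "ennreal (real k * h) + ennreal h = ennreal (real (Suc k) * h)"
    using h by (simp add: ennreal_plus[symmetric] distrib_right add.commute del: ennreal_plus)
  finally show ?case using reg' S' by simp
qed

end

text \<open>C is chosen before n, the coefficients and f, which expresses what it may depend on.
  Integrability and differentiability are part of the conclusion because otherwise the integral
  could be the default value 0 and \<open>grad\<close> could refer to an arbitrary value of
  \<open>frechet_derivative\<close>.\<close>

theorem proposition3p4:
  fixes T lam :: real and \<mu> :: "real measure"
    and K\<^sub>b K\<^sub>b\<^sub>b K\<^sub>\<sigma> K\<^sub>\<gamma> K\<^sub>\<sigma>\<^sub>\<sigma> K\<^sub>\<gamma>\<^sub>\<gamma> :: real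
  assumes "T > 0" and "lam > 0"
    and "prob_space \<mu>"
    and "\<exists>p\<in>borel_measurable lborel. \<mu> = density lborel p"
    and "integrable \<mu> (\<lambda>u. u\<^sup>2)"
  shows "\<exists>C>0. \<forall>(n::nat) (b :: real^'d::finite \<Rightarrow> real^'d)
      (\<sigma> :: real^'d \<Rightarrow> real^'q::finite^'d) (\<gamma> :: real^'d \<Rightarrow> real^'d) (f :: real^'d \<Rightarrow> real).
    real n > lam * T \<longrightarrow>
    twice_differentiable b \<longrightarrow> twice_differentiable \<sigma> \<longrightarrow> twice_differentiable \<gamma> \<longrightarrow>
    (\<forall>x. norm (D1 b x) \<le> K\<^sub>b) \<longrightarrow>
    (\<forall>x. norm (D2 b x) \<le> K\<^sub>b\<^sub>b) \<longrightarrow>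
    (\<forall>x. norm (D1 \<sigma> x) \<le> K\<^sub>\<sigma>) \<longrightarrow>
    (\<forall>x. norm (D1 \<gamma> x) \<le> K\<^sub>\<gamma>) \<longrightarrow>
    (\<forall>i j x. op_norm (partial2 i j \<sigma> x ** transpose (\<sigma> x)) \<le> K\<^sub>\<sigma>\<^sub>\<sigma>) \<longrightarrow>
    (\<forall>i j x. op_norm (col_matrix (partial2 i j \<gamma> x) ** transpose (col_matrix (\<gamma> x))) \<le> K\<^sub>\<gamma>\<^sub>\<gamma>) \<longrightarrow>
    twice_differentiable f \<longrightarrow> (\<exists>L. L-lipschitz_on UNIV (grad f)) \<longrightarrow>
    (let h = T / real n;
         t = (\<lambda>k. real k * h);
         P = euler_transition lam h \<mu> b \<sigma> \<gamma>
     in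
       (\<forall>k<n. \<forall>x. integrable (noise (lam * h) \<mu>)
          (\<lambda>w. (P ^^ k) f (euler_step lam h \<mu> b \<sigma> \<gamma> x w))) \<and>
       (\<forall>k\<le>n. \<forall>x. (P ^^ k) f differentiable (at x)) \<and>
       Lip_const (P f) \<le> ennreal (1 + C * h) * Lip_const f \<and>
       Lip_const (grad (P f)) \<le>
         ennreal (1 + C * h) * Lip_const (grad f) + ennreal h * D2_sup b * sup_norm (grad f) \<and>
       (\<forall>k\<le>n. Lip_const (grad ((P ^^ k) f)) \<le>
          ennreal (exp (C * t k)) *
            (Lip_const (grad f) + ennreal (t k) * D2_sup b * sup_norm (grad f))))"
proof -
  define s where "s = (\<integral>u. u\<^sup>2 \<partial>\<mu>)"
  define d where "d = real CARD('d)"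
  define v where "v = gauss_var TYPE('q)"
  \<comment> \<open>The bracket bounds (\<open>flow_bound\<close> - 1) / h, using h <= T for the
    square of h times the drift bound; the last two terms are the Stein and jump contributions. The
    leading 1 makes C positive even if all bounds vanish, and absolute values occur because the
    signs of the bounds are known only once coefficient functions are given.\<close>
  define C where "C = 1 + (2 * \<bar>K\<^sub>b\<bar> + T * K\<^sub>b\<^sup>2 + K\<^sub>\<sigma>\<^sup>2 * v + lam * s * K\<^sub>\<gamma>\<^sup>2)
    + d ^ 4 * \<bar>K\<^sub>\<sigma>\<^sub>\<sigma>\<bar> + lam * s * (d\<^sup>2 * \<bar>K\<^sub>\<gamma>\<^sub>\<gamma>\<bar>)"
  have s: "0 \<le> s" by (simp add: s_def)
  have v: "0 \<le> v" by (simp add: v_def gauss_var_nonneg)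
  have d: "0 \<le> d" by (simp add: d_def)
  have C: "C > 0"
    unfolding C_def using s v d \<open>T > 0\<close> \<open>lam > 0\<close> by (intro add_pos_nonneg add_nonneg_nonneg mult_nonneg_nonneg) auto
  show ?thesis
  proof (intro exI[of _ C] conjI C allI impI)
    fix n :: nat and b :: "real^'d \<Rightarrow> real^'d" and \<sigma> :: "real^'d \<Rightarrow> real^'q^'d"
      and \<gamma> :: "real^'d \<Rightarrow> real^'d" and f :: "real^'d \<Rightarrow> real"
    assume n: "real n > lam * T"
      and b2: "twice_differentiable b" and s2: "twice_differentiable \<sigma>" and g2: "twice_differentiable \<gamma>"
      and Db: "\<forall>x. norm (D1 b x) \<le> K\<^sub>b" and Ds: "\<forall>x. norm (D1 \<sigma> x) \<le> K\<^sub>\<sigma>" and Dg: "\<forall>x. norm (D1 \<gamma> x) \<le> K\<^sub>\<gamma>"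
      and Dss: "\<forall>i j x. op_norm (partial2 i j \<sigma> x ** transpose (\<sigma> x)) \<le> K\<^sub>\<sigma>\<^sub>\<sigma>"
      and Dgg: "\<forall>i j x. op_norm (col_matrix (partial2 i j \<gamma> x) ** transpose (col_matrix (\<gamma> x))) \<le> K\<^sub>\<gamma>\<^sub>\<gamma>"
      and f2: "twice_differentiable f" and f_lip: "\<exists>L. L-lipschitz_on UNIV (grad f)"
    define h where "h = T / real n"
    have n0: "real n > 0" using n mult_pos_pos[OF \<open>lam > 0\<close> \<open>T > 0\<close>] by linarith
    have h: "0 < h" using n0 \<open>T > 0\<close> by (simp add: h_def)
    have "h \<le> T" using n0 \<open>T > 0\<close> by (simp add: h_def divide_le_eq)
    interpret mu: prob_space \<mu> by fact
    interpret E: euler_scheme "lam * h" \<mu> h b \<sigma> \<gamma> K\<^sub>b K\<^sub>\<sigma> K\<^sub>\<gamma> K\<^sub>\<sigma>\<^sub>\<sigma> K\<^sub>\<gamma>\<^sub>\<gamma>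
    proof
      show "0 \<le> lam * h" using h \<open>lam > 0\<close> by simp
      \<comment> \<open>The condition n > lam T makes lam h a probability.\<close>
      show "lam * h \<le> 1" using n n0 by (simp add: h_def)
      show "sets \<mu> = sets borel"
        using \<open>\<exists>p\<in>borel_measurable lborel. \<mu> = density lborel p\<close> by auto
      show "integrable \<mu> (\<lambda>u. u\<^sup>2)" by fact
    qed (use h b2 s2 g2 Db Ds Dg Dss Dgg in auto)
    let ?P = "euler_transition lam h \<mu> b \<sigma> \<gamma>"
    let ?G = "1 + C * h"
    let ?S = "sup_norm (grad f)" and ?D = "D2_sup b"
    have step: "euler_step lam h \<mu> b \<sigma> \<gamma> x = E.X x" for x
      by (auto simp: fun_eq_iff euler_step_def E.X_def E.jump_def scaleR_matrix_vector_assoc)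
    have P: "?P = E.P"
      by (simp add: fun_eq_iff euler_transition_def E.P_def step E.noise_eq)
    have \<theta>: "E.\<theta> = lam * h * s" by (simp add: E.\<theta>_def s_def)
    have hh: "h\<^sup>2 * K\<^sub>b\<^sup>2 \<le> h * (T * K\<^sub>b\<^sup>2)"
      using h \<open>h \<le> T\<close> by (simp add: power2_eq_square mult_right_mono)
    have nonneg: "0 \<le> d ^ 4 * \<bar>K\<^sub>\<sigma>\<^sub>\<sigma>\<bar> * h" "0 \<le> lam * s * (d\<^sup>2 * \<bar>K\<^sub>\<gamma>\<^sub>\<gamma>\<bar>) * h"
      using s d h \<open>lam > 0\<close> by auto
    have K_nonneg: "0 \<le> K\<^sub>\<sigma>\<^sub>\<sigma>" "0 \<le> K\<^sub>\<gamma>\<^sub>\<gamma>"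
      using Dss Dgg op_norm_nonneg order_trans by blast+
    let ?A = "h * (2 * \<bar>K\<^sub>b\<bar> + T * K\<^sub>b\<^sup>2 + K\<^sub>\<sigma>\<^sup>2 * v + lam * s * K\<^sub>\<gamma>\<^sup>2)"
    have flow: "E.flow_bound \<le> 1 + ?A"
      unfolding E.flow_bound_def \<theta> v_def[symmetric] using hh E.K_nonneg
      by (simp add: power2_sum power_mult_distrib algebra_simps)
    have "E.hessian_growth = E.flow_bound + d ^ 4 * \<bar>K\<^sub>\<sigma>\<^sub>\<sigma>\<bar> * h + lam * s * (d\<^sup>2 * \<bar>K\<^sub>\<gamma>\<^sub>\<gamma>\<bar>) * h"
      unfolding E.hessian_growth_def \<theta> d_def[symmetric] using K_nonneg by simp
    moreover have "?G = 1 + h + ?A + d ^ 4 * \<bar>K\<^sub>\<sigma>\<^sub>\<sigma>\<bar> * h + lam * s * (d\<^sup>2 * \<bar>K\<^sub>\<gamma>\<^sub>\<gamma>\<bar>) * h"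
      unfolding C_def by (simp add: algebra_simps)
    ultimately have G: "E.flow_bound \<le> ?G" "E.hessian_growth \<le> ?G"
      using flow nonneg h by linarith+
    have G1: "1 \<le> ?G" using C h by simp
    have diff: "\<And>x. f differentiable (at x)"
      using f2 by (simp add: twice_differentiable_def)
    have reg: "E.regular f"
      unfolding E.regular_def using f_lip diff grad_differentiable[OF f2]
      by (auto dest: Lip_const_le_of_lipschitz_on intro: le_less_trans)
    note growth = E.grad_linear_growth_funpow_P[OF E.regular_grad_linear_growth[OF reg]]
    have grad_le: "Lip_const (grad ((?P ^^ k) f)) \<le>
        ennreal (?G ^ k) * (Lip_const (grad f) + ennreal (real k * h) * ?D * ?S)" for k
    proof (cases "?D * ?S < \<infinity>")
      case True
      with E.funpow_P_bounds[OF reg True G, of k] show ?thesis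
        by (simp add: P mult.assoc)
    next
      case False
      then have DS: "?D * ?S = top" by (simp add: less_top[symmetric])
      show ?thesis
      \<comment> \<open>For k = 0 the infinite source is multiplied by time 0, and 0 * infinity = 0
        leaves a trivial inequality. For k > 0 the right-hand side is infinite.\<close>
      proof (cases k)
        case (Suc m)
        then have "ennreal (real k * h) * ?D * ?S = top"
          using h by (simp add: DS mult.assoc ennreal_mult_top)
        moreover have "ennreal (?G ^ k) \<noteq> 0"
          using G1 by (simp add: ennreal_eq_0_iff not_le)
        ultimately show ?thesis by (simp add: ennreal_mult_top)
      qed simp
    qed
    show "let h = T / real n;
         t = (\<lambda>k. real k * h);
         P = euler_transition lam h \<mu> b \<sigma> \<gamma>
     in
       (\<forall>k<n. \<forall>x. integrable (noise (lam * h) \<mu>)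
          (\<lambda>w. (P ^^ k) f (euler_step lam h \<mu> b \<sigma> \<gamma> x w))) \<and>
       (\<forall>k\<le>n. \<forall>x. (P ^^ k) f differentiable (at x)) \<and>
       Lip_const (P f) \<le> ennreal (1 + C * h) * Lip_const f \<and>
       Lip_const (grad (P f)) \<le>
         ennreal (1 + C * h) * Lip_const (grad f) + ennreal h * D2_sup b * sup_norm (grad f) \<and>
       (\<forall>k\<le>n. Lip_const (grad ((P ^^ k) f)) \<le>
          ennreal (exp (C * t k)) *
            (Lip_const (grad f) + ennreal (t k) * D2_sup b * sup_norm (grad f)))"
      unfolding Let_def h_def[symmetric]
    proof (intro conjI allI impI)
      show "integrable (noise (lam * h) \<mu>) (\<lambda>w. (?P ^^ k) f (euler_step lam h \<mu> b \<sigma> \<gamma> x w))" for k x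
        unfolding step P E.noise_eq by (rule E.integrable_X[OF growth])
      show "(?P ^^ k) f differentiable (at x)" for k x
        using growth[of k] by (simp add: P grad_linear_growth_def)
      show "Lip_const (?P f) \<le> ennreal ?G * Lip_const f"
        unfolding P using G(1)
        by (intro order_trans[OF E.Lip_const_P_le[OF E.regular_grad_linear_growth[OF reg]]]
            mult_right_mono ennreal_leI) auto
      show "Lip_const (grad (?P f)) \<le> ennreal ?G * Lip_const (grad f) + ennreal h * ?D * ?S"
      proof (cases "?D * ?S < \<infinity>")
        case True
        have "ennreal E.hessian_growth * Lip_const (grad f) \<le> ennreal ?G * Lip_const (grad f)"
          using G(2) by (intro mult_right_mono ennreal_leI) auto
        then show ?thesis
          unfolding P mult.assoc by (intro order_trans[OF E.Lip_const_grad_P_le[OF reg True]] add_right_mono)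
      next
        case False
        then have "?D * ?S = top" by (simp add: less_top[symmetric])
        then show ?thesis using h by (simp add: mult.assoc ennreal_mult_top)
      qed
      show "Lip_const (grad ((?P ^^ k) f)) \<le> ennreal (exp (C * (real k * h))) *
          (Lip_const (grad f) + ennreal (real k * h) * ?D * ?S)" for k
      proof -
        have "?G ^ k \<le> exp (C * h) ^ k"
          using G1 exp_ge_add_one_self[of "C * h"] by (intro power_mono) auto
        also have "\<dots> = exp (C * (real k * h))"
          by (simp add: exp_of_nat_mult[symmetric] mult_ac)
        finally show ?thesis
          by (intro order_trans[OF grad_le] mult_right_mono ennreal_leI) auto
      qed
    qed
  qed
qed

end
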